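(* Let $\Omega$ be an open, strictly convex subset of $\mathbb{R}^2$ with smooth boundary, axially symmetric (i.e. $(x,y)\in\Omega$ implies $(-x,y),(x,-y)\in\Omega$), and satisfying \[ [-1,1]\times[-1,1]\subset\Omega\subset[-\tfrac43,\tfrac43]\times[-\tfrac43,\tfrac43]. \] Let $u:\Omega\to\mathbb{R}$ be a convex solution of \[ \frac{\det D^2u}{(1+|Du|^2)^{3/2}}=\frac{2\pi}{\mathcal{A}(\Omega)}\ \text{in }\Omega,\qquad \lim_{x\to\partial\Omega}|Du|(x)=+\infty, \] where $\mathcal{A}(\Omega)$ is the area of $\Omega$. Then for all $\epsilon\in(0,1/2)$ and $\alpha\in(0,1/6)$, \[ \partial_x u(1-5\alpha,-1+\epsilon)\le 2+3\cot\frac{\pi\alpha^2}{2}. \] *)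

theory Defs
  imports "HOL-Analysis.Analysis"
begin

definition px :: "(real \<times> real \<Rightarrow> real) \<Rightarrow> real \<times> real \<Rightarrow> real" where
  "px f = (\<lambda>p. deriv (\<lambda>t. f (fst p + t, snd p)) 0)"

definition py :: "(real \<times> real \<Rightarrow> real) \<Rightarrow> real \<times> real \<Rightarrow> real" where
  "py f = (\<lambda>p. deriv (\<lambda>t. f (fst p, snd p + t)) 0)"

fun iter_pd :: "bool list \<Rightarrow> (real \<times> real \<Rightarrow> real) \<Rightarrow> real \<times> real \<Rightarrow> real" where
  "iter_pd [] f = f"
| "iter_pd (b # bs) f = (if b then px else py) (iter_pd bs f)"

definition smooth_on :: "(real \<times> real) set \<Rightarrow> (real \<times> real \<Rightarrow> real) \<Rightarrow> bool" where
  "smooth_on S f \<longleftrightarrow> (\<forall>ds. iter_pd ds f differentiable_on S)"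

definition C2_on :: "(real \<times> real) set \<Rightarrow> (real \<times> real \<Rightarrow> real) \<Rightarrow> bool" where
  "C2_on S f \<longleftrightarrow> f differentiable_on S \<and> px f differentiable_on S \<and> py f differentiable_on S
     \<and> (\<forall>ds. length ds = 2 \<longrightarrow> continuous_on S (iter_pd ds f))"

definition smooth_boundary :: "(real \<times> real) set \<Rightarrow> bool" where
  "smooth_boundary \<Omega> \<longleftrightarrow> (\<exists>g. smooth_on UNIV g \<and> \<Omega> = {p. g p < 0}
      \<and> (\<forall>p\<in>frontier \<Omega>. (px g p, py g p) \<noteq> (0, 0)))"

definition strictly_convex :: "(real \<times> real) set \<Rightarrow> bool" where
  "strictly_convex \<Omega> \<longleftrightarrow> convex \<Omega> \<and>
     (\<forall>a\<in>closure \<Omega>. \<forall>b\<in>closure \<Omega>. a \<noteq> b \<longrightarrow> open_segment a b \<subseteq> \<Omega>)"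

definition axially_symmetric :: "(real \<times> real) set \<Rightarrow> bool" where
  "axially_symmetric \<Omega> \<longleftrightarrow> (\<forall>x y. (x, y) \<in> \<Omega> \<longrightarrow> (-x, y) \<in> \<Omega> \<and> (x, -y) \<in> \<Omega>)"

definition grad_norm :: "(real \<times> real \<Rightarrow> real) \<Rightarrow> real \<times> real \<Rightarrow> real" where
  "grad_norm u p = sqrt ((px u p)\<^sup>2 + (py u p)\<^sup>2)"

definition hess_det :: "(real \<times> real \<Rightarrow> real) \<Rightarrow> real \<times> real \<Rightarrow> real" where
  "hess_det u p = px (px u) p * py (py u) p - py (px u) p * px (py u) p"

end

(*
  Write p for the point in question and suppose that N <= u_x(p) with N = 6 / (pi alpha^2).

  Upper barrier.  The function w = K / (X + Y + sqrt (2 X Y)) on a quadrant satisfies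
  det D^2 w = (2 / K) |Dw|^3 and has infinite slope along both sides of the quadrant.  Comparing u
  with w on the right triangle with hypotenuse from p to a point q above and to the right of p (on
  the hypotenuse u <= max (u p) (u q) by convexity) bounds u on the horizontal side from above,
  while u_x(p) >= N makes u grow at least linearly there.  Hence u(q) >= u(p) + N (q - p)_x - B
  with B of order 1 / alpha.

  Gauss map.  By the tangent inequality, Du(q).(q - p) >= N (q - p)_x - B for all q in a triangle E
  near the right-hand side of the square.  For fixed Du(q) this is affine in q, so it holds at a
  vertex of E, which puts Du(q) into one of two half-planes.  Their masses for the density
  (1 + |P|^2)^(-3/2), twice the opening angle of a spherical lune, add up to less than the mass
  that the equation assigns to Du(E).
*)
theory Submission
  imports Defs
begin

section \<open>Partial derivatives and quadratic forms\<close>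

text \<open>\<open>px\<close> and \<open>py\<close> are built on \<open>deriv\<close>, which carries
  information only where the partial derivatives exist. Total differentiability makes them the
  coefficients of the derivative, so that the chain rule applies to them.\<close>

lemma differentiable_has_derivative_partials:
  assumes "f differentiable (at z)"
  shows "(f has_derivative (\<lambda>v. fst v * px f z + snd v * py f z)) (at z)"
proof -
  obtain f' where f': "(f has_derivative f') (at z)"
    using assms by (auto simp: differentiable_def)
  then interpret f': bounded_linear f' by (rule has_derivative_bounded_linear)
  have "((\<lambda>t. f (z + t *\<^sub>R v)) has_derivative (\<lambda>t. f' (t *\<^sub>R v))) (at 0)" for v
    by (rule has_derivative_compose[where f = "\<lambda>t. z + t *\<^sub>R v", unfolded o_def])
       (auto intro!: derivative_eq_intros f')
  then have *: "((\<lambda>t. f (z + t *\<^sub>R v)) has_real_derivative f' v) (at 0)" for v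
    by (simp add: has_field_derivative_def f'.scaleR mult_commute_abs)
  have "px f z = f' (1, 0)" "py f z = f' (0, 1)"
    using *[of "(1, 0)"] *[of "(0, 1)"]
    by (auto simp: px_def py_def plus_prod_def intro!: DERIV_imp_deriv)
  moreover have "f' = (\<lambda>v. fst v * f' (1, 0) + snd v * f' (0, 1))"
  proof
    fix v
    have "v = fst v *\<^sub>R (1, 0) + snd v *\<^sub>R (0, 1)" by (cases v) simp
    then show "f' v = fst v * f' (1, 0) + snd v * f' (0, 1)"
      by (metis f'.add f'.scaleR real_scaleR_def)
  qed
  ultimately show ?thesis
    using f' by metis
qed

lemma has_real_derivative_along_line:
  assumes "f differentiable (at (z + t *\<^sub>R v))"
  shows "((\<lambda>t. f (z + t *\<^sub>R v)) has_real_derivative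
           fst v * px f (z + t *\<^sub>R v) + snd v * py f (z + t *\<^sub>R v)) (at t)"
proof -
  have "((\<lambda>t. f (z + t *\<^sub>R v)) has_derivative
      (\<lambda>s. fst (s *\<^sub>R v) * px f (z + t *\<^sub>R v) + snd (s *\<^sub>R v) * py f (z + t *\<^sub>R v))) (at t)"
    by (rule has_derivative_compose[where f = "\<lambda>t. z + t *\<^sub>R v", unfolded o_def])
       (auto intro!: derivative_eq_intros differentiable_has_derivative_partials[OF assms])
  moreover have "(\<lambda>s. fst (s *\<^sub>R v) * a + snd (s *\<^sub>R v) * b) = (*) (fst v * a + snd v * b)" for a b
    by (auto simp: algebra_simps)
  ultimately show ?thesis
    by (simp only: has_field_derivative_def)
qed

text \<open>The mean value theorem in the first variable turns the second difference into
  \<open>h * (P (x + s, y + h) - P (x + s, y))\<close>; in the linearisation of \<open>P\<close> at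
  the point the \<open>a\<close> terms cancel and \<open>h * b\<close> remains.\<close>

lemma double_difference_bound:
  fixes F P :: "real \<times> real \<Rightarrow> real"
  assumes "open S" "(x, y) \<in> S"
    and F: "\<And>s t. (s, t) \<in> S \<Longrightarrow> ((\<lambda>r. F (r, t)) has_real_derivative P (s, t)) (at s)"
    and P: "(P has_derivative (\<lambda>v. fst v * a + snd v * b)) (at (x, y))"
    and "0 < e"
  shows "\<exists>d>0. \<forall>h. 0 < h \<and> h < d \<longrightarrow>
    \<bar>F (x + h, y + h) - F (x, y + h) - F (x + h, y) + F (x, y) - h\<^sup>2 * b\<bar> \<le> e * h\<^sup>2"
proof -
  \<comment> \<open>Increments have norm at most \<open>2 * h\<close> and two values of
    \<open>P\<close> are subtracted, so a tolerance of \<open>e / 4\<close> adds up to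
    \<open>e * h\<close>.\<close>
  have "\<exists>d>0. \<forall>w. norm (w - (x, y)) < d \<longrightarrow> norm (P w - P (x, y)
      - (fst (w - (x, y)) * a + snd (w - (x, y)) * b)) \<le> e / 4 * norm (w - (x, y))"
    using P \<open>0 < e\<close> unfolding has_derivative_at_alt by (meson divide_pos_pos zero_less_numeral)
  then obtain d1 where d1: "d1 > 0" and
      D: "\<And>w. norm (w - (x, y)) < d1 \<Longrightarrow> norm (P w - P (x, y)
      - (fst (w - (x, y)) * a + snd (w - (x, y)) * b)) \<le> e / 4 * norm (w - (x, y))"
    by blast
  obtain d2 where d2: "d2 > 0" "ball (x, y) d2 \<subseteq> S"
    using assms(1,2) open_contains_ball by blast
  define d where "d = min d1 d2 / 2"
  have "d > 0" using d1 d2 by (simp add: d_def)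
  moreover have "\<bar>F (x + h, y + h) - F (x, y + h) - F (x + h, y) + F (x, y) - h\<^sup>2 * b\<bar> \<le> e * h\<^sup>2"
    if h: "0 < h" "h < d" for h
  proof -
    have small: "norm ((x + s, y + t) - (x, y)) < min d1 d2"
        "norm ((x + s, y + t) - (x, y)) \<le> 2 * h" if "0 \<le> s" "s \<le> h" "0 \<le> t" "t \<le> h" for s t
    proof -
      have "norm ((x + s, y + t) - (x, y)) \<le> \<bar>s\<bar> + \<bar>t\<bar>"
        using norm_Pair_le[of s t] by simp
      then show "norm ((x + s, y + t) - (x, y)) \<le> 2 * h" using that by linarith
      then show "norm ((x + s, y + t) - (x, y)) < min d1 d2" using h by (simp add: d_def)
    qed
    have inS: "(x + s, y + t) \<in> S" if "0 \<le> s" "s \<le> h" "0 \<le> t" "t \<le> h" for s t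
      using small(1)[OF that] d2(2)
      by (auto simp: subset_iff dist_norm norm_minus_commute)
    have dF: "((\<lambda>s. F (x + s, y + t)) has_real_derivative P (x + s, y + t)) (at s)"
      if "0 \<le> s" "s \<le> h" "0 \<le> t" "t \<le> h" for s t
      using DERIV_chain2[of "\<lambda>r. F (r, y + t)" "P (x + s, y + t)" "\<lambda>s. x + s" s 1 UNIV] F[OF inS[OF that]]
      by (simp add: DERIV_cong[OF DERIV_add[OF DERIV_const DERIV_ident]])
    have "((\<lambda>s. F (x + s, y + h) - F (x + s, y)) has_real_derivative
        P (x + s, y + h) - P (x + s, y)) (at s)" if "0 \<le> s" "s \<le> h" for s
      using DERIV_diff[OF dF[of s h] dF[of s 0]] that h by simp
    from MVT2[OF h(1) this] obtain s where s: "0 < s" "s < h" and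
      eq: "F (x + h, y + h) - F (x + h, y) - (F (x, y + h) - F (x, y))
         = h * (P (x + s, y + h) - P (x + s, y))" by auto
    have PB: "\<bar>P (x + s, y + t) - P (x, y) - (s * a + t * b)\<bar> \<le> e / 2 * h"
      if "0 \<le> s" "s \<le> h" "0 \<le> t" "t \<le> h" for s t
    proof -
      have "\<bar>P (x + s, y + t) - P (x, y) - (s * a + t * b)\<bar> \<le> e / 4 * norm ((x + s, y + t) - (x, y))"
        using D[of "(x + s, y + t)"] small(1)[OF that] by simp
      also have "\<dots> \<le> e / 4 * (2 * h)"
        using small(2)[OF that] \<open>0 < e\<close> by (intro mult_left_mono) auto
      finally show ?thesis by simp
    qed
    have "\<bar>P (x + s, y + h) - P (x + s, y) - h * b\<bar> \<le> e * h"
      using PB[of s h] PB[of s 0] s h unfolding abs_le_iff by simp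
    then have "h * \<bar>P (x + s, y + h) - P (x + s, y) - h * b\<bar> \<le> h * (e * h)"
      using h by (intro mult_left_mono) auto
    moreover have "F (x + h, y + h) - F (x, y + h) - F (x + h, y) + F (x, y) - h\<^sup>2 * b
        = h * (P (x + s, y + h) - P (x + s, y) - h * b)"
      using eq by (simp add: algebra_simps power2_eq_square)
    ultimately show ?thesis
      using h by (simp only: abs_mult abs_of_pos power2_eq_square mult.left_commute)
  qed
  ultimately show ?thesis by blast
qed

text \<open>The second difference over a square does not change when the coordinates are swapped, so
  \<open>double_difference_bound\<close> for \<open>f\<close> and for \<open>f\<close> after the
  swap approximates one quantity by both mixed partials. With \<open>e\<close> a third of their
  distance, two errors \<open>e\<close> cannot bridge the gap.\<close>

lemma mixed_partials_symmetric:
  assumes "open S" "z \<in> S" "f differentiable_on S"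
    and "px f differentiable (at z)" "py f differentiable (at z)"
  shows "py (px f) z = px (py f) z"
proof (rule ccontr)
  assume ne: "\<not> ?thesis"
  obtain x y where z: "z = (x, y)" by (cases z)
  define e where "e = \<bar>py (px f) z - px (py f) z\<bar> / 3"
  have "e > 0" using ne by (simp add: e_def)
  have diff: "f differentiable (at w)" if "w \<in> S" for w
    using assms that by (metis at_within_open differentiable_on_def)
  have X: "((\<lambda>r. f (r, t)) has_real_derivative px f (s, t)) (at s)" if "(s, t) \<in> S" for s t
    using has_real_derivative_along_line[of f "(0, t)" s "(1, 0)"] diff[OF that] by simp
  have Y: "((\<lambda>r. f (t, r)) has_real_derivative py f (t, s)) (at s)" if "(t, s) \<in> S" for s t
    using has_real_derivative_along_line[of f "(t, 0)" s "(0, 1)"] diff[OF that] by simp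
  obtain d1 where d1: "d1 > 0" and A: "\<And>h. 0 < h \<Longrightarrow> h < d1 \<Longrightarrow>
      \<bar>f (x + h, y + h) - f (x, y + h) - f (x + h, y) + f (x, y) - h\<^sup>2 * py (px f) z\<bar> \<le> e * h\<^sup>2"
    using double_difference_bound[of S x y f "px f" "px (px f) z" "py (px f) z" e]
      differentiable_has_derivative_partials[OF assms(4)] assms X z \<open>e > 0\<close> by auto
  have swp: "((\<lambda>w. py f (prod.swap w)) has_derivative
      (\<lambda>v. fst v * py (py f) z + snd v * px (py f) z)) (at (y, x))"
  proof -
    have sw: "(prod.swap has_derivative prod.swap) (at (y, x) :: (real \<times> real) filter)"
      unfolding prod.swap_def by (auto intro!: derivative_eq_intros)
    have "((\<lambda>w. py f (prod.swap w)) has_derivative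
      (\<lambda>v. fst (prod.swap v) * px (py f) z + snd (prod.swap v) * py (py f) z)) (at (y, x))"
      using differentiable_has_derivative_partials[OF assms(5)] z
      by (intro has_derivative_compose[OF sw]) auto
    then show ?thesis by (simp add: algebra_simps)
  qed
  have "open (prod.swap -` S)"
    by (rule continuous_open_vimage)
       (auto simp: prod.swap_def assms(1) intro!: continuous_intros)
  then obtain d2 where d2: "d2 > 0" and B: "\<And>h. 0 < h \<Longrightarrow> h < d2 \<Longrightarrow>
      \<bar>f (x + h, y + h) - f (x + h, y) - f (x, y + h) + f (x, y) - h\<^sup>2 * px (py f) z\<bar> \<le> e * h\<^sup>2"
    using double_difference_bound[of "prod.swap -` S" y x "\<lambda>w. f (prod.swap w)" "\<lambda>w. py f (prod.swap w)"
        "py (py f) z" "px (py f) z" e] swp assms Y z \<open>e > 0\<close> by auto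
  define h where "h = min d1 d2 / 2"
  have h: "0 < h" "h < d1" "h < d2" using d1 d2 by (auto simp: h_def)
  have "\<bar>h\<^sup>2 * py (px f) z - h\<^sup>2 * px (py f) z\<bar> \<le> 2 * (e * h\<^sup>2)"
    using A[OF h(1,2)] B[OF h(1,3)] by linarith
  moreover have "\<bar>h\<^sup>2 * py (px f) z - h\<^sup>2 * px (py f) z\<bar> = 3 * (e * h\<^sup>2)"
    by (simp add: e_def abs_mult flip: right_diff_distrib)
  ultimately have "e * h\<^sup>2 \<le> 0" by linarith
  then show False using h \<open>e > 0\<close> by (simp add: mult_le_0_iff)
qed

section \<open>Second-order conditions at a maximum and determinants of binary forms\<close>

lemma second_derivative_local_max:
  fixes f f' :: "real \<Rightarrow> real"
  assumes "0 < d" and f: "\<And>t. \<bar>t\<bar> < d \<Longrightarrow> (f has_real_derivative f' t) (at t)"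
    and f': "(f' has_real_derivative m) (at 0)"
    and max: "\<And>t. \<bar>t\<bar> < d \<Longrightarrow> f t \<le> f 0"
  shows "f' 0 = 0" "m \<le> 0"
proof -
  show 0: "f' 0 = 0"
    using DERIV_local_max[OF f[of 0] \<open>0 < d\<close>] max \<open>0 < d\<close> by auto
  show "m \<le> 0"
  proof (rule ccontr)
    assume "\<not> m \<le> 0"
    then obtain e where e: "e > 0" "\<And>h. 0 < h \<Longrightarrow> h < e \<Longrightarrow> f' 0 < f' h"
      using DERIV_pos_inc_right[OF f'] by auto
    define b where "b = min d e / 2"
    have b: "0 < b" "b < d" "b < e" using e \<open>0 < d\<close> by (auto simp: b_def)
    have "\<exists>s. 0 < s \<and> s < b \<and> f b - f 0 = (b - 0) * f' s"
      using b by (intro MVT2 f) auto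
    then obtain s where "0 < s" "s < b" "f b - f 0 = b * f' s" by auto
    then show False using max[of b] b e(2)[of s] 0
      by (smt (verit) mult_pos_pos)
  qed
qed

text \<open>Multiplication by \<open>a\<close> completes the square: the form becomes
  \<open>(a * s + b * t)\<^sup>2 + (a * c - b\<^sup>2) * t\<^sup>2\<close>.\<close>

lemma binary_quadratic_form_pos:
  fixes a b c :: real
  assumes "\<And>s t. 0 \<le> a * s\<^sup>2 + 2 * b * s * t + c * t\<^sup>2" "0 < a * c - b\<^sup>2" "s \<noteq> 0 \<or> t \<noteq> 0"
  shows "0 < a" "0 < a * s\<^sup>2 + 2 * b * s * t + c * t\<^sup>2"
proof -
  have "0 \<le> a" using assms(1)[of 1 0] by simp
  moreover have "a \<noteq> 0" using assms(2) by auto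
  ultimately show "0 < a" by simp
  have eq: "a * (a * s\<^sup>2 + 2 * b * s * t + c * t\<^sup>2) = (a * s + b * t)\<^sup>2 + (a * c - b\<^sup>2) * t\<^sup>2"
    by (simp add: power2_eq_square algebra_simps)
  have "0 < (a * s + b * t)\<^sup>2 + (a * c - b\<^sup>2) * t\<^sup>2"
  proof (cases "t = 0")
    case True
    then show ?thesis using assms(3) \<open>0 < a\<close> by simp
  next
    case False
    then show ?thesis using assms(2) by (intro add_nonneg_pos) auto
  qed
  then show "0 < a * s\<^sup>2 + 2 * b * s * t + c * t\<^sup>2"
    using eq \<open>0 < a\<close> by (metis zero_less_mult_pos)
qed

text \<open>At \<open>t = 1\<close> the minimum over \<open>s\<close> of a form with positive
  leading coefficient is determinant over leading coefficient. Comparing both forms at the minimiser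
  \<open>- (B / A)\<close> of the larger one compares these quotients, and \<open>a \<le> A\<close>
  then compares the determinants.\<close>

lemma binary_quadratic_form_det_mono:
  fixes a b c A B C :: real
  assumes le: "\<And>s t. a * s\<^sup>2 + 2 * b * s * t + c * t\<^sup>2 \<le> A * s\<^sup>2 + 2 * B * s * t + C * t\<^sup>2"
    and "0 < a" "0 \<le> a * c - b\<^sup>2"
  shows "a * c - b\<^sup>2 \<le> A * C - B\<^sup>2"
proof -
  have "a \<le> A" using le[of 1 0] by simp
  then have "0 < A" using assms by simp
  define s where "s = - (B / A)"
  have s: "A * s = - B" using \<open>0 < A\<close> by (simp add: s_def)
  have "A * (A * s\<^sup>2 + 2 * B * s + C) = (A * s)\<^sup>2 + 2 * B * (A * s) + A * C"
    by (simp add: power2_eq_square algebra_simps)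
  also have "\<dots> = A * C - B\<^sup>2" by (simp add: s power2_eq_square)
  finally have Q2: "A * s\<^sup>2 + 2 * B * s + C = (A * C - B\<^sup>2) / A"
    using \<open>0 < A\<close> by (simp add: field_simps)
  have "a * (a * s\<^sup>2 + 2 * b * s + c) = (a * s + b)\<^sup>2 + (a * c - b\<^sup>2)"
    by (simp add: power2_eq_square algebra_simps)
  then have "a * c - b\<^sup>2 \<le> a * (a * s\<^sup>2 + 2 * b * s + c)" by simp
  also have "\<dots> \<le> a * ((A * C - B\<^sup>2) / A)"
    using le[of s 1] Q2 \<open>0 < a\<close> by (intro mult_left_mono) auto
  finally have *: "a * c - b\<^sup>2 \<le> a * ((A * C - B\<^sup>2) / A)" .
  then have "0 \<le> (A * C - B\<^sup>2) / A"
    using assms by (smt (verit) mult_pos_neg)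
  then have "a * ((A * C - B\<^sup>2) / A) \<le> A * ((A * C - B\<^sup>2) / A)"
    using \<open>a \<le> A\<close> by (intro mult_right_mono)
  with * \<open>0 < A\<close> show ?thesis by simp
qed

section \<open>Convex functions with positive Hessian determinant\<close>

definition hess_form :: "(real \<times> real \<Rightarrow> real) \<Rightarrow> real \<times> real \<Rightarrow> real \<times> real \<Rightarrow> real" where
  "hess_form f z v = px (px f) z * (fst v)\<^sup>2 + 2 * py (px f) z * fst v * snd v + py (py f) z * (snd v)\<^sup>2"

locale convex_C2 =
  fixes S :: "(real \<times> real) set" and u :: "real \<times> real \<Rightarrow> real"
  assumes open_S: "open S" and convex_u: "convex_on S u" and C2: "C2_on S u"
begin

lemma differentiable_u:
  assumes "z \<in> S"
  shows "u differentiable (at z)" "px u differentiable (at z)" "py u differentiable (at z)"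
  using C2 assms open_S unfolding C2_on_def differentiable_on_def
  by (metis at_within_open)+

lemma mixed_partials_eq: "z \<in> S \<Longrightarrow> py (px u) z = px (py u) z"
  using mixed_partials_symmetric[OF open_S] differentiable_u C2 C2_on_def by blast

lemma hess_det_eq: "z \<in> S \<Longrightarrow> hess_det u z = px (px u) z * py (py u) z - (py (px u) z)\<^sup>2"
  by (simp add: hess_det_def mixed_partials_eq power2_eq_square)

lemma along_line_1:
  assumes "z + t *\<^sub>R v \<in> S"
  shows "((\<lambda>t. u (z + t *\<^sub>R v)) has_real_derivative
           fst v * px u (z + t *\<^sub>R v) + snd v * py u (z + t *\<^sub>R v)) (at t)"
  using has_real_derivative_along_line differentiable_u(1)[OF assms] .

lemma along_line_2:
  assumes "z + t *\<^sub>R v \<in> S"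
  shows "((\<lambda>t. fst v * px u (z + t *\<^sub>R v) + snd v * py u (z + t *\<^sub>R v)) has_real_derivative
           hess_form u (z + t *\<^sub>R v) v) (at t)"
proof -
  let ?w = "z + t *\<^sub>R v"
  have "((\<lambda>t. fst v * px u (z + t *\<^sub>R v) + snd v * py u (z + t *\<^sub>R v)) has_real_derivative
      fst v * (fst v * px (px u) ?w + snd v * py (px u) ?w)
      + snd v * (fst v * px (py u) ?w + snd v * py (py u) ?w)) (at t)"
    using differentiable_u[OF assms]
    by (intro DERIV_add DERIV_cmult has_real_derivative_along_line)
  then show ?thesis
    by (simp add: hess_form_def mixed_partials_eq[OF assms] power2_eq_square algebra_simps)
qed

lemma above_tangent:
  assumes "p \<in> S" "q \<in> S"
  shows "u p + (fst (q - p) * px u p + snd (q - p) * py u p) \<le> u q"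
proof -
  define A where "A = (\<lambda>t. p + t *\<^sub>R (q - p)) -` S"
  have "open A" unfolding A_def
    by (rule continuous_open_vimage[OF open_S]) (auto intro!: continuous_intros)
  have comb: "p + ((1 - t) *\<^sub>R a + t *\<^sub>R b) *\<^sub>R (q - p)
      = (1 - t) *\<^sub>R (p + a *\<^sub>R (q - p)) + t *\<^sub>R (p + b *\<^sub>R (q - p))" for a b t :: real
    by (simp add: algebra_simps)
  have "convex S" using convex_u by (rule convex_on_imp_convex)
  then have "convex A"
    unfolding convex_alt A_def vimage_def mem_Collect_eq comb by blast
  have "convex_on A (\<lambda>t. u (p + t *\<^sub>R (q - p)))"
  proof (rule convex_onI)
    fix t x y :: real assume "0 < t" "t < 1" "x \<in> A" "y \<in> A"
    then show "u (p + ((1 - t) *\<^sub>R x + t *\<^sub>R y) *\<^sub>R (q - p))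
        \<le> (1 - t) * u (p + x *\<^sub>R (q - p)) + t * u (p + y *\<^sub>R (q - p))"
      unfolding comb by (intro convex_onD[OF convex_u]) (auto simp: A_def)
  qed fact
  moreover have "0 \<in> A" "1 \<in> A" using assms by (auto simp: A_def)
  ultimately have "(fst (q - p) * px u p + snd (q - p) * py u p) * (1 - 0)
      \<le> u (p + 1 *\<^sub>R (q - p)) - u (p + 0 *\<^sub>R (q - p))"
    using \<open>open A\<close> \<open>convex A\<close> along_line_1[of p 0 "q - p"] assms
    by (intro convex_on_imp_above_tangent[of A])
       (auto simp: convex_connected interior_open intro: DERIV_subset)
  then show ?thesis by simp
qed

text \<open>A negative value would make the slope along \<open>v\<close> decrease just after
  \<open>z\<close>, whereas the tangent inequalities at both ends of a short segment show that it
  cannot decrease.\<close>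

lemma hess_form_nonneg:
  assumes "z \<in> S"
  shows "0 \<le> hess_form u z v"
proof (rule ccontr)
  let ?g = "\<lambda>t. fst v * px u (z + t *\<^sub>R v) + snd v * py u (z + t *\<^sub>R v)"
  assume "\<not> 0 \<le> hess_form u z v"
  then obtain d where d: "d > 0" "\<And>h. 0 < h \<Longrightarrow> h < d \<Longrightarrow> ?g h < ?g 0"
    using DERIV_neg_dec_right[OF along_line_2[of z 0 v]] assms by auto
  have "open ((\<lambda>t. z + t *\<^sub>R v) -` S)"
    by (rule continuous_open_vimage[OF open_S]) (auto intro!: continuous_intros)
  then obtain e where "e > 0" and ball: "ball 0 e \<subseteq> (\<lambda>t. z + t *\<^sub>R v) -` S"
    by (rule openE[of _ 0]) (use assms in simp_all)
  then have e: "z + t *\<^sub>R v \<in> S" if "\<bar>t\<bar> < e" for t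
    using that by (auto simp: subset_iff dist_real_def)
  define h where "h = min d e / 2"
  have h: "0 < h" "h < d" "h < e" using d \<open>e > 0\<close> by (auto simp: h_def)
  have "h * ?g 0 \<le> u (z + h *\<^sub>R v) - u z"
    using above_tangent[OF assms e[of h]] h by (simp add: algebra_simps)
  moreover have "u (z + h *\<^sub>R v) - u z \<le> h * ?g h"
    using above_tangent[OF e[of h] assms] h by (simp add: algebra_simps)
  ultimately have "h * ?g 0 \<le> h * ?g h" by simp
  with d(2)[OF h(1,2)] h show False by simp
qed

lemma hess_form_pos:
  assumes "z \<in> S" "0 < hess_det u z"
  shows "0 < px (px u) z" "v \<noteq> 0 \<Longrightarrow> 0 < hess_form u z v"
proof -
  have nonneg: "0 \<le> px (px u) z * s\<^sup>2 + 2 * py (px u) z * s * t + py (py u) z * t\<^sup>2" for s t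
    using hess_form_nonneg[OF assms(1), of "(s, t)"] by (simp add: hess_form_def)
  show "0 < px (px u) z"
    using binary_quadratic_form_pos(1)[OF nonneg, of 1 1] assms by (simp add: hess_det_eq)
  show "0 < hess_form u z v" if "v \<noteq> 0"
    using binary_quadratic_form_pos(2)[OF nonneg, of "fst v" "snd v"] assms that
    by (simp add: hess_det_eq hess_form_def prod_eq_iff)
qed

text \<open>The component of the gradient along \<open>q - p\<close> has the positive Hessian form
  as its derivative on the segment, so it is strictly larger at \<open>q\<close> than at
  \<open>p\<close>. This is the injectivity for the change of variables.\<close>

lemma gradient_inj:
  assumes pos: "\<And>z. z \<in> S \<Longrightarrow> 0 < hess_det u z"
    and "p \<in> S" "q \<in> S" "px u p = px u q" "py u p = py u q"
  shows "p = q"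
proof (rule ccontr)
  assume "p \<noteq> q"
  let ?v = "q - p"
  let ?g = "\<lambda>t. fst ?v * px u (p + t *\<^sub>R ?v) + snd ?v * py u (p + t *\<^sub>R ?v)"
  have "p + t *\<^sub>R ?v \<in> S" if "0 \<le> t" "t \<le> 1" for t
    using convexD_alt[OF convex_on_imp_convex[OF convex_u] \<open>p \<in> S\<close> \<open>q \<in> S\<close> that]
    by (simp add: algebra_simps)
  then have "\<exists>y. (?g has_real_derivative y) (at t) \<and> 0 < y" if "0 \<le> t" "t \<le> 1" for t
    using along_line_2[of p t ?v] hess_form_pos(2)[OF _ pos, of "p + t *\<^sub>R ?v" ?v] that \<open>p \<noteq> q\<close>
    by auto
  then have "?g 0 < ?g 1"
    by (rule DERIV_pos_imp_increasing[OF zero_less_one])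
  then show False using assms by simp
qed

end

section \<open>The corner barrier\<close>

text \<open>In the variables $x = -X$, $y = -Y$ this is the Legendre transform of
  \<^term>\<open>\<lambda>P Q :: real. - sqrt (4 * K * (P + Q - sqrt (P\<^sup>2 + Q\<^sup>2)))\<close>, the solution of the
  dual equation on the first quadrant that vanishes on both half-axes.\<close>
definition corner_barrier :: "real \<Rightarrow> real \<Rightarrow> real \<Rightarrow> real" where
  "corner_barrier K X Y = K / (X + Y + sqrt (2 * X * Y))"

lemma corner_barrier_commute: "corner_barrier K X Y = corner_barrier K Y X"
  by (simp add: corner_barrier_def ac_simps)

lemma corner_barrier_edge: "0 < X \<Longrightarrow> corner_barrier K X 0 = K / X"
  by (simp add: corner_barrier_def)

lemma corner_barrier_nonneg: "0 < K \<Longrightarrow> 0 \<le> X \<Longrightarrow> 0 \<le> Y \<Longrightarrow> 0 \<le> corner_barrier K X Y"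
  by (simp add: corner_barrier_def)

text \<open>Gives the blow-up at the corner \<open>X = Y = 0\<close>; the reason is
  \<open>sqrt (2 * X * Y) \<le> X + Y\<close>.\<close>

lemma corner_barrier_lower:
  assumes "0 < K" "0 \<le> X" "0 \<le> Y" "0 < X + Y"
  shows "K / (2 * (X + Y)) \<le> corner_barrier K X Y"
proof -
  have "0 \<le> X\<^sup>2 + Y\<^sup>2" by simp
  then have "2 * X * Y \<le> (X + Y)\<^sup>2" unfolding power2_sum by linarith
  then have "sqrt (2 * X * Y) \<le> X + Y" using assms by (intro real_le_lsqrt) auto
  then show ?thesis
    using assms unfolding corner_barrier_def
    by (intro divide_left_mono mult_pos_pos add_pos_nonneg[OF \<open>0 < X + Y\<close>]) auto
qed

text \<open>Infinite slope at the side \<open>Y = 0\<close>: the drop equals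
  \<open>K * (Y + r) / (X * (X + Y + r))\<close> with \<open>r = sqrt (2 * X * Y)\<close>, and a
  square root beats every linear function near 0.\<close>

lemma corner_barrier_steep:
  assumes "0 < X" "0 < K"
  shows "\<exists>d>0. \<forall>Y. 0 < Y \<and> Y < d \<longrightarrow> C * Y < corner_barrier K X 0 - corner_barrier K X Y"
proof -
  \<comment> \<open>For \<open>Y \<le> X\<close> the drop is at least
    \<open>K * r / (4 * X\<^sup>2)\<close>, so \<open>D * Y < r\<close> is enough, which means
    \<open>Y < 2 * X / D\<^sup>2\<close>.\<close>
  define D where "D = max 1 (4 * X\<^sup>2 * C / K)"
  define d where "d = min X (2 * X / D\<^sup>2)"
  have D: "D \<ge> 1" "4 * X\<^sup>2 * C / K \<le> D" by (auto simp: D_def)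
  have "d > 0" using assms D by (auto simp: d_def)
  moreover have "C * Y < corner_barrier K X 0 - corner_barrier K X Y" if Y: "0 < Y" "Y < d" for Y
  proof -
    define r where "r = sqrt (2 * X * Y)"
    have "0 < r" using assms Y by (simp add: r_def)
    have "r\<^sup>2 = 2 * X * Y" using assms Y by (simp add: r_def)
    have "2 * X * Y \<le> (2 * X)\<^sup>2" using assms Y by (simp add: d_def power2_eq_square)
    then have "r \<le> 2 * X" unfolding r_def using assms by (intro real_le_lsqrt) auto
    have "(D * Y)\<^sup>2 < r\<^sup>2"
    proof -
      have "Y * D\<^sup>2 < 2 * X" using Y D by (simp add: d_def pos_less_divide_eq)
      then have "Y * (Y * D\<^sup>2) < Y * (2 * X)" using Y by (intro mult_strict_left_mono)
      then show ?thesis unfolding \<open>r\<^sup>2 = 2 * X * Y\<close> by (simp add: power2_eq_square algebra_simps)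
    qed
    then have "D * Y < r" using \<open>0 < r\<close> by (simp add: power_less_imp_less_base)
    have "C * Y = K * (4 * X\<^sup>2 * C / K * Y) / (4 * X\<^sup>2)" using assms by simp
    also have "\<dots> \<le> K * (D * Y) / (4 * X\<^sup>2)"
      using assms D Y by (intro divide_right_mono mult_left_mono mult_right_mono) auto
    also have "\<dots> < K * r / (4 * X\<^sup>2)"
      using assms \<open>D * Y < r\<close> by (intro divide_strict_right_mono mult_strict_left_mono) auto
    also have "\<dots> \<le> K * (Y + r) / (X * (X + Y + r))"
    proof (rule frac_le)
      have "X * (X + Y + r) \<le> X * (X + X + 2 * X)"
        using assms Y \<open>r \<le> 2 * X\<close> by (intro mult_left_mono) (auto simp: d_def)
      then show "X * (X + Y + r) \<le> 4 * X\<^sup>2" by (simp add: power2_eq_square)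
    qed (use assms Y \<open>0 < r\<close> in auto)
    also have "\<dots> = corner_barrier K X 0 - corner_barrier K X Y"
      using assms Y \<open>0 < r\<close> add_pos_pos[of "X + Y" r]
      by (simp add: corner_barrier_def flip: r_def) (simp add: field_simps)
    finally show ?thesis .
  qed
  ultimately show ?thesis by blast
qed

lemma sqrt_product_deriv:
  assumes "0 < X + t * a" "0 < Y + t * b"
  shows "((\<lambda>t. sqrt (2 * (X + t * a) * (Y + t * b))) has_real_derivative
    (a * (Y + t * b) + b * (X + t * a)) / sqrt (2 * (X + t * a) * (Y + t * b))) (at t)"
proof -
  have "0 < 2 * (X + t * a) * (Y + t * b)" using assms by simp
  then show ?thesis
    by (auto intro!: derivative_eq_intros simp: field_simps)
qed

lemma corner_barrier_deriv1:
  assumes "0 < X + t * a" "0 < Y + t * b"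
  defines "r \<equiv> sqrt (2 * (X + t * a) * (Y + t * b))"
  shows "((\<lambda>t. corner_barrier K (X + t * a) (Y + t * b)) has_real_derivative
    - K * (a + b + (a * (Y + t * b) + b * (X + t * a)) / r) / (X + t * a + (Y + t * b) + r)\<^sup>2) (at t)"
proof -
  have "0 < r" using assms by simp
  then have "0 < X + t * a + (Y + t * b) + r" using assms(1,2) by linarith
  moreover have "((\<lambda>t. X + t * a + (Y + t * b) + sqrt (2 * (X + t * a) * (Y + t * b)))
      has_real_derivative a + b + (a * (Y + t * b) + b * (X + t * a)) / r) (at t)"
    unfolding r_def
    by (intro DERIV_add sqrt_product_deriv assms) (auto intro!: derivative_eq_intros)
  ultimately show ?thesis
    using DERIV_divide[OF DERIV_const[of K]] unfolding corner_barrier_def r_def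
    by (fastforce simp: power2_eq_square)
qed

text \<open>For \<open>S = X + Y + r\<close> along the line,
  \<open>(K / S)'' = 2 * K * S'\<^sup>2 / S ^ 3 - K * S'' / S\<^sup>2\<close>, and only
  \<open>r\<close> contributes to \<open>S''\<close>. The result is a sum of two squares of linear
  forms in \<open>(a, b)\<close>, from which the Hessian determinant can be read off.\<close>

lemma corner_barrier_deriv2:
  assumes "0 < X" "0 < Y"
  defines "r \<equiv> sqrt (2 * X * Y)"
  shows "((\<lambda>t. - K * (a + b + (a * (Y + t * b) + b * (X + t * a)) / sqrt (2 * (X + t * a) * (Y + t * b)))
      / (X + t * a + (Y + t * b) + sqrt (2 * (X + t * a) * (Y + t * b)))\<^sup>2) has_real_derivative
    2 * K / (X + Y + r) ^ 3 * (a + b + (a * Y + b * X) / r)\<^sup>2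
    + K / (r ^ 3 * (X + Y + r)\<^sup>2) * (a * Y - b * X)\<^sup>2) (at 0)"
proof -
  let ?r = "\<lambda>t. sqrt (2 * (X + t * a) * (Y + t * b))"
  let ?n = "\<lambda>t. a * (Y + t * b) + b * (X + t * a)"
  let ?s = "\<lambda>t. a + b + ?n t / ?r t"
  let ?S = "\<lambda>t. X + t * a + (Y + t * b) + ?r t"
  define S where "S = X + Y + r"
  have r: "0 < r" "r\<^sup>2 = 2 * X * Y" using assms by simp_all
  have "0 < S" using assms(1,2) r(1) unfolding S_def by linarith
  have r0: "?r 0 = r" by (simp add: r_def)
  have n0: "?n 0 = a * Y + b * X" by simp
  have rne: "r \<noteq> 0" using r(1) by simp
  have dr: "(?r has_real_derivative (a * Y + b * X) / r) (at 0)"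
    using sqrt_product_deriv[of X 0 a Y b] assms by simp
  \<comment> \<open>This is \<open>r\<^sup>2\<close> times the second derivative of
    \<open>sqrt (2 * X * Y)\<close> along the line, reduced with
    \<open>r\<^sup>2 = 2 * X * Y\<close>.\<close>
  have "r * (2 * a * b) - (a * Y + b * X) * ((a * Y + b * X) / r) = - (a * Y - b * X)\<^sup>2 / r"
  proof -
    have "(r * (2 * a * b) - (a * Y + b * X) * ((a * Y + b * X) / r)) * r
        = 2 * a * b * r\<^sup>2 - (a * Y + b * X)\<^sup>2"
      using r(1) by (simp add: field_simps power2_eq_square)
    also have "\<dots> = - (a * Y - b * X)\<^sup>2"
      unfolding r(2) by (simp add: power2_eq_square algebra_simps)
    finally show ?thesis using r(1) by (simp add: field_simps)
  qed
  moreover have "(?s has_real_derivative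
      (r * (2 * a * b) - (a * Y + b * X) * ((a * Y + b * X) / r)) / r\<^sup>2) (at 0)"
  proof -
    have "(?n has_real_derivative 2 * a * b) (at 0)"
      by (auto intro!: derivative_eq_intros)
    from DERIV_add[OF DERIV_const[of "a + b"] DERIV_divide[OF this dr, unfolded r0 n0, OF rne]]
    show ?thesis by (rule DERIV_cong) (simp add: power2_eq_square mult.commute)
  qed
  ultimately have ds: "(?s has_real_derivative - (a * Y - b * X)\<^sup>2 / r ^ 3) (at 0)"
    using r(1) by (simp add: power2_eq_square power3_eq_cube mult.assoc)
  have dS: "(?S has_real_derivative ?s 0) (at 0)"
    unfolding r0 n0 by (intro DERIV_add dr) (auto intro!: derivative_eq_intros)
  have S0: "?S 0 = S" by (simp add: S_def r_def)
  have "((\<lambda>t. - K * ?s t / (?S t)\<^sup>2) has_real_derivative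
      ((- K * (- (a * Y - b * X)\<^sup>2 / r ^ 3)) * S\<^sup>2 - (- K * ?s 0) * (2 * S * ?s 0)) / (S\<^sup>2 * S\<^sup>2)) (at 0)"
    by (rule DERIV_cong[OF DERIV_divide[OF DERIV_cmult[OF ds, of "- K"] DERIV_power[OF dS, of 2], unfolded S0]])
       (use \<open>0 < S\<close> in \<open>simp_all add: mult_ac\<close>)
  moreover have "((- K * (- (a * Y - b * X)\<^sup>2 / r ^ 3)) * S\<^sup>2 - (- K * ?s 0) * (2 * S * ?s 0)) / (S\<^sup>2 * S\<^sup>2)
    = 2 * K / S ^ 3 * (?s 0)\<^sup>2 + K / (r ^ 3 * S\<^sup>2) * (a * Y - b * X)\<^sup>2"
  proof -
    have "((- K * (- D / R)) * S\<^sup>2 - (- K * s) * (2 * S * s)) / (S\<^sup>2 * S\<^sup>2)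
        = 2 * K / S ^ 3 * s\<^sup>2 + K / (R * S\<^sup>2) * D" if "R > 0" for D R s
      using that \<open>0 < S\<close> by (simp add: field_simps power2_eq_square power3_eq_cube)
    then show ?thesis using r(1) by simp
  qed
  ultimately show ?thesis
    unfolding r0 by (simp add: S_def)
qed

section \<open>Comparison of the solution with the corner barrier\<close>

context convex_C2
begin

text \<open>At an interior maximum of the difference the gradients agree and the Hessian of
  \<open>u\<close> is at most that of the barrier. Hence \<open>hess_det u z\<close> is at most the
  barrier determinant \<open>2 / K * grad_norm u z ^ 3\<close>, strictly below what
  \<open>det\<close> demands.\<close>

lemma barrier_no_interior_max:
  assumes "0 < K" and X: "0 < x2 - fst z" and Y: "0 < snd z - y1"
    and "z \<in> S" "0 < d"
    and max: "\<And>w. dist w z < d \<Longrightarrow> u w - corner_barrier K (x2 - fst w) (snd w - y1)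
        \<le> u z - corner_barrier K (x2 - fst z) (snd z - y1)"
    and det: "2 / K * (1 + (grad_norm u z)\<^sup>2) powr (3/2) \<le> hess_det u z"
  shows False
proof -
  define X where "X = x2 - fst z"
  define Y where "Y = snd z - y1"
  define r where "r = sqrt (2 * X * Y)"
  define T where "T = X + Y + r"
  \<comment> \<open>\<open>a\<close> and \<open>b\<close> are the partial derivatives of
    \<open>X + Y + sqrt (2 * X * Y)\<close>.\<close>
  define a where "a = 1 + Y / r"
  define b where "b = 1 + X / r"
  have pos: "0 < X" "0 < Y" using assms by (auto simp: X_def Y_def)
  then have r: "0 < r" "r\<^sup>2 = 2 * X * Y" by (simp_all add: r_def)
  have T: "0 < T" using pos r by (simp add: T_def)
  obtain d' where d': "d' > 0" "ball z d' \<subseteq> S"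
    using open_S \<open>z \<in> S\<close> open_contains_ball by blast
  define m where "m = min (min d d') (min X Y)"
  have m: "m > 0" "m \<le> d" "m \<le> d'" "m \<le> X" "m \<le> Y"
    using \<open>0 < d\<close> d' pos by (auto simp: m_def)
  \<comment> \<open>First and second order conditions on the line through \<open>z\<close> in
    direction \<open>v\<close>; \<open>X\<close> falls as the first coordinate grows, hence
    \<open>- fst v\<close>. Displacements below \<open>m\<close> stay in \<open>S\<close>, in the
    ball of the maximum and in the open quadrant.\<close>
  have along: "fst v * px u z + snd v * py u z = - K * (- fst v + snd v + (- fst v * Y + snd v * X) / r) / T\<^sup>2"
    "hess_form u z v \<le> 2 * K / T ^ 3 * (- fst v + snd v + (- fst v * Y + snd v * X) / r)\<^sup>2
        + K / (r ^ 3 * T\<^sup>2) * (- fst v * Y - snd v * X)\<^sup>2" for v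
  proof -
    define e where "e = m / (norm v + 1)"
    have "e > 0" using m by (simp add: e_def add_nonneg_pos)
    have near: "z + t *\<^sub>R v \<in> S" "dist (z + t *\<^sub>R v) z < d" "0 < X + t * - fst v" "0 < Y + t * snd v"
      if "\<bar>t\<bar> < e" for t
    proof -
      have "\<bar>t\<bar> * norm v \<le> \<bar>t\<bar> * (norm v + 1)" by (simp add: mult_left_mono)
      also have "\<dots> < e * (norm v + 1)" using that by (intro mult_strict_right_mono) (auto simp: add_nonneg_pos)
      also have "\<dots> = m" using norm_ge_zero[of v] by (simp add: e_def del: norm_ge_zero)
      finally have tv: "norm (t *\<^sub>R v) < m" by simp
      then show "dist (z + t *\<^sub>R v) z < d" using m by (simp add: dist_norm)
      have "dist z (z + t *\<^sub>R v) < d'" using m tv by (simp add: dist_norm)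
      then show "z + t *\<^sub>R v \<in> S" using d'(2) by (meson mem_ball subsetD)
      have "\<bar>t * fst v\<bar> < m" "\<bar>t * snd v\<bar> < m"
        using norm_fst_le[of "t * fst v" "t * snd v"] norm_snd_le[of "t * snd v" "t * fst v"] tv
        by (simp_all add: scaleR_prod_def)
      then show "0 < X + t * - fst v" "0 < Y + t * snd v" using m by auto
    qed
    let ?W' = "\<lambda>t. - K * (- fst v + snd v + (- fst v * (Y + t * snd v) + snd v * (X + t * - fst v))
        / sqrt (2 * (X + t * - fst v) * (Y + t * snd v)))
        / (X + t * - fst v + (Y + t * snd v) + sqrt (2 * (X + t * - fst v) * (Y + t * snd v)))\<^sup>2"
    let ?f = "\<lambda>t. u (z + t *\<^sub>R v) - corner_barrier K (X + t * - fst v) (Y + t * snd v)"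
    let ?f' = "\<lambda>t. (fst v * px u (z + t *\<^sub>R v) + snd v * py u (z + t *\<^sub>R v)) - ?W' t"
    have f: "(?f has_real_derivative ?f' t) (at t)" if "\<bar>t\<bar> < e" for t
      by (intro DERIV_diff along_line_1 corner_barrier_deriv1 near that)
    have f': "(?f' has_real_derivative hess_form u (z + 0 *\<^sub>R v) v -
       (2 * K / (X + Y + r) ^ 3 * (- fst v + snd v + (- fst v * Y + snd v * X) / r)\<^sup>2
        + K / (r ^ 3 * (X + Y + r)\<^sup>2) * (- fst v * Y - snd v * X)\<^sup>2)) (at 0)"
      unfolding r_def by (intro DERIV_diff along_line_2 corner_barrier_deriv2 pos) (simp add: \<open>z \<in> S\<close>)
    have fmax: "?f t \<le> ?f 0" if "\<bar>t\<bar> < e" for t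
      using max[OF near(2)[OF that]] by (simp add: X_def Y_def algebra_simps)
    have "?f' 0 = 0"
      by (rule second_derivative_local_max(1)[OF \<open>e > 0\<close> f f' fmax])
    then show "fst v * px u z + snd v * py u z = - K * (- fst v + snd v + (- fst v * Y + snd v * X) / r) / T\<^sup>2"
      by (simp add: T_def r_def)
    show "hess_form u z v \<le> 2 * K / T ^ 3 * (- fst v + snd v + (- fst v * Y + snd v * X) / r)\<^sup>2
        + K / (r ^ 3 * T\<^sup>2) * (- fst v * Y - snd v * X)\<^sup>2"
      using second_derivative_local_max(2)[OF \<open>e > 0\<close> f f' fmax] by (simp add: T_def)
  qed
  have px: "px u z = K * a / T\<^sup>2"
    using along(1)[of "(1, 0)"] by (simp add: a_def algebra_simps diff_divide_distrib)
  have py: "py u z = - K * b / T\<^sup>2"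
    using along(1)[of "(0, 1)"] by (simp add: b_def)
  have ab: "(a\<^sup>2 + b\<^sup>2) * r\<^sup>2 = T\<^sup>2"
  proof -
    have "(a\<^sup>2 + b\<^sup>2) * r\<^sup>2 = (r + Y)\<^sup>2 + (r + X)\<^sup>2"
      using r(1) unfolding a_def b_def by (simp add: field_simps power2_eq_square)
    also have "\<dots> = T\<^sup>2" using r(2) unfolding T_def power2_eq_square by (simp add: algebra_simps)
    finally show ?thesis .
  qed
  have "(grad_norm u z)\<^sup>2 = (K / (r * T))\<^sup>2"
  proof -
    have "(grad_norm u z)\<^sup>2 = K\<^sup>2 * (a\<^sup>2 + b\<^sup>2) / T ^ 4"
      using T by (simp add: grad_norm_def px py power_divide power_mult_distrib distrib_left add_divide_distrib
          flip: power_mult)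
    also have "\<dots> = K\<^sup>2 * ((a\<^sup>2 + b\<^sup>2) * r\<^sup>2) / (r\<^sup>2 * T ^ 4)" using r(1) by simp
    also have "\<dots> = (K / (r * T))\<^sup>2"
      unfolding ab using r(1) T by (simp add: field_simps eval_nat_numeral)
    finally show ?thesis .
  qed
  then have G: "grad_norm u z = K / (r * T)"
    using \<open>0 < K\<close> r T by (simp add: grad_norm_def power2_eq_iff_nonneg)
  have S1: "a * X + b * Y = T"
  proof -
    have "(a * X + b * Y) * r = (X + Y) * r + 2 * X * Y"
      using r(1) unfolding a_def b_def by (simp add: field_simps)
    also have "\<dots> = T * r" unfolding r(2)[symmetric] T_def by (simp add: power2_eq_square algebra_simps)
    finally show ?thesis using r(1) by simp
  qed
  define P where "P = 2 * K / T ^ 3"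
  define Q where "Q = K / (r ^ 3 * T\<^sup>2)"
  have le: "px (px u) z * s\<^sup>2 + 2 * py (px u) z * s * t + py (py u) z * t\<^sup>2
    \<le> (P * a\<^sup>2 + Q * Y\<^sup>2) * s\<^sup>2 + 2 * (Q * X * Y - P * a * b) * s * t + (P * b\<^sup>2 + Q * X\<^sup>2) * t\<^sup>2" for s t
  proof -
    have "- s + t + (- s * Y + t * X) / r = t * b - s * a"
      using r(1) by (simp add: a_def b_def field_simps)
    then have "hess_form u z (s, t) \<le> P * (t * b - s * a)\<^sup>2 + Q * (- s * Y - t * X)\<^sup>2"
      using along(2)[of "(s, t)"] by (simp add: P_def Q_def)
    then show ?thesis by (simp add: hess_form_def power2_eq_square algebra_simps)
  qed
  have "0 < hess_det u z"
    using det \<open>0 < K\<close> by (smt (verit) divide_pos_pos mult_pos_pos powr_gt_zero zero_le_power2)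
  then have "hess_det u z \<le> (P * a\<^sup>2 + Q * Y\<^sup>2) * (P * b\<^sup>2 + Q * X\<^sup>2) - (Q * X * Y - P * a * b)\<^sup>2"
    using binary_quadratic_form_det_mono[OF le hess_form_pos(1)[OF \<open>z \<in> S\<close>]] hess_det_eq[OF \<open>z \<in> S\<close>]
    by simp
  \<comment> \<open>A combination of two squared linear forms with weights \<open>P\<close> and
    \<open>Q\<close> has determinant \<open>P * Q\<close> times the squared determinant of their
    coefficients, here \<open>a * X + b * Y = T\<close>.\<close>
  also have "\<dots> = P * Q * (a * X + b * Y)\<^sup>2" by (simp add: power2_eq_square algebra_simps)
  also have "\<dots> = 2 / K * (grad_norm u z) ^ 3"
    unfolding S1 G P_def Q_def using r(1) T \<open>0 < K\<close>
    by (simp add: field_simps power2_eq_square power3_eq_cube)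
  also have "\<dots> < 2 / K * (1 + (grad_norm u z)\<^sup>2) powr (3/2)"
  proof (intro mult_strict_left_mono)
    have "0 < grad_norm u z" using G \<open>0 < K\<close> r T by simp
    then have "(grad_norm u z) ^ 3 = ((grad_norm u z)\<^sup>2) powr (3/2)"
      by (simp add: powr_powr flip: powr_numeral)
    also have "\<dots> < (1 + (grad_norm u z)\<^sup>2) powr (3/2)" by (intro powr_less_mono2) auto
    finally show "(grad_norm u z) ^ 3 < (1 + (grad_norm u z)\<^sup>2) powr (3/2)" .
  qed (use \<open>0 < K\<close> in simp)
  finally show False using det by simp
qed

text \<open>The barrier is placed with its corner at \<open>(x2, y1)\<close>, the right angle of the
  triangle below the diagonal of the box. If the bound failed, the maximum of \<open>f\<close> over
  the triangle would exceed \<open>M\<close>; it is then excluded at the corner, on the hypotenuse,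
  on both legs and in the interior.\<close>

lemma barrier_comparison:
  assumes "0 < K" "x1 < x2" "y1 < y2" and box: "{x1..x2} \<times> {y1..y2} \<subseteq> S"
    and det: "\<And>z. z \<in> S \<Longrightarrow> 2 / K * (1 + (grad_norm u z)\<^sup>2) powr (3/2) \<le> hess_det u z"
    and x: "x1 \<le> x" "x < x2"
  shows "u (x, y1) \<le> K / (x2 - x) + max (u (x1, y1)) (u (x2, y2))"
proof (rule ccontr)
  define f where "f = (\<lambda>w. u w - corner_barrier K (x2 - fst w) (snd w - y1))"
  define M where "M = max (u (x1, y1)) (u (x2, y2))"
  define T where "T = {w. x1 \<le> fst w \<and> fst w \<le> x2 \<and> y1 \<le> snd w
      \<and> (snd w - y1) * (x2 - x1) \<le> (y2 - y1) * (fst w - x1)}"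
  assume "\<not> ?thesis"
  moreover have "f (x, y1) = u (x, y1) - K / (x2 - x)"
    using x by (simp add: f_def corner_barrier_edge)
  ultimately have above: "M < f (x, y1)" unfolding M_def by linarith
  have T_box: "T \<subseteq> {x1..x2} \<times> {y1..y2}"
  proof
    fix w assume w: "w \<in> T"
    then have "(snd w - y1) * (x2 - x1) \<le> (y2 - y1) * (fst w - x1)" by (simp add: T_def)
    also have "\<dots> \<le> (y2 - y1) * (x2 - x1)"
      using w \<open>y1 < y2\<close> by (intro mult_left_mono) (auto simp: T_def)
    finally have "(snd w - y1) * (x2 - x1) \<le> (y2 - y1) * (x2 - x1)" .
    then have "snd w - y1 \<le> y2 - y1" using \<open>x1 < x2\<close> by simp
    then show "w \<in> {x1..x2} \<times> {y1..y2}"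
      using w by (auto simp: T_def mem_Times_iff)
  qed
  then have "T \<subseteq> S" using box by blast
  have "closed T" unfolding T_def
    by (intro closed_Collect_conj closed_Collect_le continuous_intros)
  have "compact T"
    using compact_Int_closed[OF compact_Times[OF compact_Icc compact_Icc] \<open>closed T\<close>] T_box
    by (metis inf.absorb2)
  have cont_u: "continuous_on T u"
    using differentiable_u(1) \<open>T \<subseteq> S\<close>
    by (meson continuous_at_imp_continuous_on differentiable_imp_continuous_within subsetD)
  have z0: "(x, y1) \<in> T" using assms by (simp add: T_def)
  obtain U where U: "\<And>w. w \<in> T \<Longrightarrow> u w \<le> U"
    using continuous_attains_sup[OF \<open>compact T\<close> _ cont_u] z0 by blast
  \<comment> \<open>Chosen so that closer than \<open>e\<close> to the corner the barrier exceeds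
    \<open>\<bar>U - f (x, y1)\<bar> + 1\<close>. The maximum can therefore be sought on the compact
    set \<open>R\<close>, where the barrier is continuous.\<close>
  define e where "e = K / (2 * (\<bar>U - f (x, y1)\<bar> + 1))"
  have "e > 0" unfolding e_def using \<open>0 < K\<close> by (intro divide_pos_pos mult_pos_pos add_nonneg_pos) auto
  define R where "R = T \<inter> {w. e \<le> x2 - fst w + (snd w - y1)}"
  have near_corner: "f w < f (x, y1)"
    if "w \<in> T" "0 < x2 - fst w + (snd w - y1)" "x2 - fst w + (snd w - y1) < e" for w
  proof -
    let ?s = "x2 - fst w + (snd w - y1)"
    have "\<bar>U - f (x, y1)\<bar> + 1 = K / (2 * e)" using \<open>0 < K\<close> by (simp add: e_def)
    also have "\<dots> < K / (2 * ?s)"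
      using that \<open>0 < K\<close> \<open>e > 0\<close> by (intro divide_strict_left_mono mult_pos_pos) auto
    also have "\<dots> \<le> corner_barrier K (x2 - fst w) (snd w - y1)"
      using that \<open>0 < K\<close> by (intro corner_barrier_lower) (auto simp: T_def)
    finally show ?thesis using U[OF that(1)] by (simp add: f_def)
  qed
  have "compact R"
    unfolding R_def using \<open>compact T\<close>
    by (intro compact_Int_closed closed_Collect_le continuous_intros)
  moreover have "continuous_on R f"
  proof -
    have "0 < x2 - fst w + (snd w - y1) + sqrt (2 * (x2 - fst w) * (snd w - y1))" if "w \<in> R" for w
    proof -
      have "0 < x2 - fst w + (snd w - y1)" using that \<open>e > 0\<close> by (simp add: R_def)
      then show ?thesis by (rule add_pos_nonneg) (use that in \<open>auto simp: R_def T_def\<close>)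
    qed
    then show ?thesis unfolding f_def corner_barrier_def
      using continuous_on_subset[OF cont_u, of R]
      by (intro continuous_intros) (auto simp: R_def dest: less_imp_neq[symmetric])
  qed
  moreover have "(x, y1) \<in> R"
    using near_corner[OF z0] z0 x by (force simp: R_def)
  ultimately obtain z where z: "z \<in> R" "\<And>w. w \<in> R \<Longrightarrow> f w \<le> f z"
    using continuous_attains_sup[of R f] by blast
  have max: "f w \<le> f z" if "w \<in> T" "0 < x2 - fst w + (snd w - y1)" for w
    using near_corner[OF that] z(2)[of w] z(2)[OF \<open>(x, y1) \<in> R\<close>] that by (force simp: R_def)
  obtain a b where ab: "z = (a, b)" by (cases z)
  have zT: "x1 \<le> a" "a \<le> x2" "y1 \<le> b" "(b - y1) * (x2 - x1) \<le> (y2 - y1) * (a - x1)"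
    "0 < x2 - a + (b - y1)" "z \<in> T"
    using z(1) \<open>e > 0\<close> by (auto simp: R_def T_def ab)
  have "z \<in> S" using zT \<open>T \<subseteq> S\<close> by blast
  \<comment> \<open>On the hypotenuse convexity gives \<open>u z \<le> M\<close>, and the barrier is
    nonnegative there.\<close>
  have "(b - y1) * (x2 - x1) \<noteq> (y2 - y1) * (a - x1)"
  proof
    assume eq: "(b - y1) * (x2 - x1) = (y2 - y1) * (a - x1)"
    define t where "t = (a - x1) / (x2 - x1)"
    have t: "0 \<le> t" "t \<le> 1" using zT \<open>x1 < x2\<close> by (auto simp: t_def)
    have a: "a - x1 = t * (x2 - x1)" using \<open>x1 < x2\<close> by (simp add: t_def)
    have "(b - y1) * (x2 - x1) = t * (y2 - y1) * (x2 - x1)" unfolding eq a by (simp add: mult_ac)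
    then have "b - y1 = t * (y2 - y1)" using \<open>x1 < x2\<close> by simp
    with a have "a = (1 - t) * x1 + t * x2" "b = (1 - t) * y1 + t * y2"
      by (auto simp: algebra_simps)
    then have z_eq: "z = (1 - t) *\<^sub>R (x1, y1) + t *\<^sub>R (x2, y2)" by (simp add: ab)
    have "u z \<le> (1 - t) * u (x1, y1) + t * u (x2, y2)"
      unfolding z_eq by (rule convex_onD[OF convex_u t]) (use box assms(2,3) in auto)
    also have "\<dots> \<le> (1 - t) * M + t * M"
      using t by (intro add_mono mult_left_mono) (auto simp: M_def)
    finally have "u z \<le> M" by (simp add: algebra_simps)
    moreover have "0 \<le> corner_barrier K (x2 - fst z) (snd z - y1)"
      using zT ab \<open>0 < K\<close> by (intro corner_barrier_nonneg) auto
    ultimately show False using above z(2)[OF \<open>(x, y1) \<in> R\<close>] by (simp add: f_def)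
  qed
  then have strict: "(b - y1) * (x2 - x1) < (y2 - y1) * (a - x1)" using zT by simp
  have "0 \<le> (b - y1) * (x2 - x1)" using zT assms by simp
  with strict have "0 < (y2 - y1) * (a - x1)" by linarith
  then have "x1 < a" using assms by (simp add: zero_less_mult_iff)
  consider "b = y1" "a < x2" | "y1 < b" "a = x2" | "y1 < b" "a < x2"
    using zT by linarith
  then show False
  proof cases
    case 1
    \<comment> \<open>On a leg, a small move into the triangle lowers the barrier faster than
      linearly, while the tangent plane lets \<open>u\<close> fall only linearly, so
      \<open>f\<close> increases. The minimum in the step length keeps the new point inside the
      triangle; the vertical leg is treated alike.\<close>
    obtain d where d: "d > 0" "\<And>Y. 0 < Y \<Longrightarrow> Y < d \<Longrightarrow>
        - py u z * Y < corner_barrier K (x2 - a) 0 - corner_barrier K (x2 - a) Y"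
      using corner_barrier_steep[of "x2 - a" K "- py u z"] 1 \<open>0 < K\<close> by auto
    define Y where "Y = min (d / 2) ((y2 - y1) * (a - x1) / (x2 - x1))"
    have Y: "0 < Y" "Y < d"
      using d(1) \<open>x1 < x2\<close> \<open>0 < (y2 - y1) * (a - x1)\<close> by (auto simp: Y_def min_less_iff_disj)
    have "Y * (x2 - x1) \<le> (y2 - y1) * (a - x1)"
      using \<open>x1 < x2\<close> by (simp add: Y_def pos_le_divide_eq[symmetric])
    then have "(a, y1 + Y) \<in> T" using zT 1 Y by (simp add: T_def)
    then have "f (a, y1 + Y) \<le> f z" using 1 Y by (intro max) auto
    moreover have "u z + Y * py u z \<le> u (a, y1 + Y)"
      using above_tangent[OF \<open>z \<in> S\<close>, of "(a, y1 + Y)"] \<open>(a, y1 + Y) \<in> T\<close> \<open>T \<subseteq> S\<close> ab 1 by auto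
    ultimately show False using d(2)[OF Y] 1 by (simp add: f_def ab mult.commute)
  next
    case 2
    obtain d where d: "d > 0" "\<And>X. 0 < X \<Longrightarrow> X < d \<Longrightarrow>
        px u z * X < corner_barrier K (b - y1) 0 - corner_barrier K (b - y1) X"
      using corner_barrier_steep[of "b - y1" K "px u z"] 2 \<open>0 < K\<close> by auto
    have gap: "0 < (y2 - y1) * (x2 - x1) - (b - y1) * (x2 - x1)" using strict 2 by simp
    define X where "X = min (d / 2) (min (x2 - x1)
        (((y2 - y1) * (x2 - x1) - (b - y1) * (x2 - x1)) / (y2 - y1)))"
    have X: "0 < X" "X < d" "X \<le> x2 - x1"
      using d(1) assms gap by (auto simp: X_def min_less_iff_disj)
    have "X \<le> ((y2 - y1) * (x2 - x1) - (b - y1) * (x2 - x1)) / (y2 - y1)" by (simp add: X_def)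
    then have "(b - y1) * (x2 - x1) \<le> (y2 - y1) * (x2 - X - x1)"
      using \<open>y1 < y2\<close> by (simp add: pos_le_divide_eq algebra_simps)
    then have "(x2 - X, b) \<in> T" using zT X by (simp add: T_def)
    then have "f (x2 - X, b) \<le> f z" using 2 X by (intro max) auto
    moreover have "u z - X * px u z \<le> u (x2 - X, b)"
      using above_tangent[OF \<open>z \<in> S\<close>, of "(x2 - X, b)"] \<open>(x2 - X, b) \<in> T\<close> \<open>T \<subseteq> S\<close> ab 2 by auto
    ultimately show False
      using d(2)[OF X(1,2)] 2 by (simp add: f_def ab mult.commute corner_barrier_commute[of K _ "b - y1"])
  next
    case 3
    define V where "V = {w. x1 < fst w \<and> fst w < x2 \<and> y1 < snd w
      \<and> (snd w - y1) * (x2 - x1) < (y2 - y1) * (fst w - x1)}"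
    have "open V" unfolding V_def
      by (intro open_Collect_conj open_Collect_less continuous_intros)
    moreover have "z \<in> V" using 3 strict \<open>x1 < a\<close> by (simp add: V_def ab)
    ultimately obtain d where d: "d > 0" "ball z d \<subseteq> V" using openE by blast
    have "f w \<le> f z" if "dist w z < d" for w
    proof -
      have "w \<in> V" using d(2) that by (auto simp: dist_commute)
      then show ?thesis by (intro max) (auto simp: V_def T_def)
    qed
    then show False
      using barrier_no_interior_max[OF \<open>0 < K\<close> _ _ \<open>z \<in> S\<close> d(1) _ det[OF \<open>z \<in> S\<close>], of x2 y1] 3 ab
      by (simp add: f_def)
  qed
qed

text \<open>At distance \<open>d\<close> before the corner, the tangent at \<open>(x1, y1)\<close>
  bounds \<open>u\<close> from below and \<open>barrier_comparison\<close> bounds it from above by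
  \<open>K / d\<close> plus the larger endpoint value. As \<open>K / d < N * (x2 - x1 - d)\<close>,
  the larger one must be \<open>u (x2, y2)\<close>.\<close>

lemma value_lower_bound:
  assumes "0 < K" "y1 \<le> y2" and box: "{x1..x2} \<times> {y1..y2} \<subseteq> S"
    and det: "\<And>z. z \<in> S \<Longrightarrow> 2 / K * (1 + (grad_norm u z)\<^sup>2) powr (3/2) \<le> hess_det u z"
    and N: "N \<le> px u (x1, y1)" and d: "0 < d" "d \<le> x2 - x1" "K / d < N * (x2 - x1 - d)"
  shows "u (x1, y1) + N * (x2 - x1) - (N * d + K / d) \<le> u (x2, y2)"
proof -
  have "0 < K / d" using assms by simp
  then have "0 < N * (x2 - x1 - d)" using d by linarith
  then have "0 < N" using d by (simp add: zero_less_mult_iff)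
  have inS: "(x1, y1) \<in> S" "(x2, y1) \<in> S" "(x2 - d, y1) \<in> S" using box assms by auto
  have tangent: "u (x1, y1) + N * (x - x1) \<le> u (x, y1)" if "(x, y1) \<in> S" "x1 \<le> x" for x
    using above_tangent[OF inS(1) that(1)] mult_left_mono[OF N, of "x - x1"] that
    by (simp add: mult.commute)
  show ?thesis
  proof (cases "y1 = y2")
    \<comment> \<open>The triangle is degenerate here; the tangent inequality alone gives more than
      is claimed.\<close>
    case True
    have "u (x1, y1) + N * (x2 - x1) \<le> u (x2, y1)" using tangent[OF inS(2)] d by simp
    then show ?thesis
      unfolding True[symmetric] using \<open>0 < K / d\<close> mult_pos_pos[OF \<open>0 < N\<close> d(1)] by linarith
  next
    case False
    have "u (x2 - d, y1) \<le> K / (x2 - (x2 - d)) + max (u (x1, y1)) (u (x2, y2))"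
      using assms False by (intro barrier_comparison) auto
    moreover have "u (x1, y1) + N * (x2 - d - x1) \<le> u (x2 - d, y1)"
      using tangent[OF inS(3)] d by simp
    ultimately show ?thesis using d by (simp add: max_def algebra_simps split: if_splits)
  qed
qed

end

section \<open>The area of the Gauss image\<close>

text \<open>Area density of the unit sphere in central projection to a tangent plane, that is, the
  density of the Gauss map in terms of the gradient.\<close>

definition sphere_density :: "real \<Rightarrow> real \<Rightarrow> real" where
  "sphere_density s t = (1 + s\<^sup>2 + t\<^sup>2) powr (-3/2)"

lemma sphere_density_measurable [measurable]:
  assumes [measurable]: "f \<in> borel_measurable M" "g \<in> borel_measurable M"
  shows "(\<lambda>x. sphere_density (f x) (g x)) \<in> borel_measurable M"
  unfolding sphere_density_def by measurable

lemma sphere_density_commute: "sphere_density s t = sphere_density t s"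
  by (simp add: sphere_density_def ac_simps)

text \<open>The integrand, centred at 0, has the antiderivative
  \<open>s / (D * sqrt (A * s\<^sup>2 + D))\<close>, with limit \<open>1 / (D * sqrt A)\<close> at
  infinity; evenness doubles the half-line integral.\<close>

lemma nn_integral_quadratic_powr_le:
  fixes A D t0 :: real
  assumes "0 < A" "0 < D"
  shows "(\<integral>\<^sup>+s. ennreal ((A * (s - t0)\<^sup>2 + D) powr (-3/2)) \<partial>lborel) \<le> ennreal (2 / (sqrt A * D))"
proof -
  define h where "h = (\<lambda>s. (A * s\<^sup>2 + D) powr (-3/2))"
  define F where "F = (\<lambda>s. s / (D * sqrt (A * s\<^sup>2 + D)))"
  have pos: "0 < A * s\<^sup>2 + D" for s using assms by (simp add: add_nonneg_pos)
  have h_meas [measurable]: "h \<in> borel_measurable borel" unfolding h_def by measurable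
  have dF: "(F has_real_derivative h s) (at s)" for s
  proof -
    define q where "q = sqrt (A * s\<^sup>2 + D)"
    have q: "q > 0" "q\<^sup>2 = A * s\<^sup>2 + D" using pos[of s] by (simp_all add: q_def)
    have "((\<lambda>s. sqrt (A * s\<^sup>2 + D)) has_real_derivative A * s / q) (at s)"
      using pos[of s] unfolding q_def by (auto intro!: derivative_eq_intros simp: field_simps)
    from DERIV_divide[OF DERIV_ident DERIV_cmult[OF this, of D]]
    have "(F has_real_derivative (1 * (D * q) - s * (D * (A * s / q))) / (D * q * (D * q))) (at s)"
      using q assms unfolding F_def q_def by simp
    moreover have "(1 * (D * q) - s * (D * (A * s / q))) / (D * q * (D * q)) = 1 / q ^ 3"
    proof -
      have "(1 * (D * q) - s * (D * (A * s / q))) * q = D * (q\<^sup>2 - A * s\<^sup>2)"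
        using q(1) by (simp add: field_simps power2_eq_square)
      also have "\<dots> = D * D" by (simp add: q(2))
      finally have "1 * (D * q) - s * (D * (A * s / q)) = D * D / q"
        using q(1) by (metis nonzero_eq_divide_eq less_irrefl)
      then show ?thesis using q(1) \<open>0 < D\<close> by (simp add: power3_eq_cube mult.assoc)
    qed
    moreover have "1 / q ^ 3 = h s"
    proof -
      have "q ^ 3 = (A * s\<^sup>2 + D) powr (3/2)"
        using pos[of s] by (simp add: q_def powr_half_sqrt[symmetric] powr_powr flip: powr_numeral)
      then show ?thesis by (simp add: h_def powr_minus_divide)
    qed
    ultimately show ?thesis by simp
  qed
  have "((\<lambda>s. s / (D * sqrt (A * s\<^sup>2 + D))) \<longlongrightarrow> 1 / (D * sqrt A)) at_top"
  proof -
    have "((\<lambda>s. 1 / (D * sqrt (A + D * (inverse s)\<^sup>2))) \<longlongrightarrow> 1 / (D * sqrt (A + D * 0\<^sup>2))) at_top"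
      using assms by (intro tendsto_intros tendsto_inverse_0_at_top filterlim_ident) auto
    moreover have "\<forall>\<^sub>F s in at_top. 1 / (D * sqrt (A + D * (inverse s)\<^sup>2)) = s / (D * sqrt (A * s\<^sup>2 + D))"
      using eventually_gt_at_top[of 0]
    proof eventually_elim
      case (elim s)
      have "A * s\<^sup>2 + D = s\<^sup>2 * (A + D * (inverse s)\<^sup>2)" using elim by (simp add: field_simps)
      then have "sqrt (A * s\<^sup>2 + D) = s * sqrt (A + D * (inverse s)\<^sup>2)"
        using elim by (simp add: real_sqrt_mult)
      then show ?case using elim by simp
    qed
    ultimately show ?thesis by (auto elim: Lim_transform_eventually)
  qed
  then have "(\<integral>\<^sup>+s. ennreal (h s) * indicator {0..} s \<partial>lborel) = ennreal (1 / (D * sqrt A) - F 0)"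
    using nn_integral_FTC_atLeast[OF h_meas dF, of 0] by (simp add: h_def F_def)
  then have half: "(\<integral>\<^sup>+s. ennreal (h s) * indicator {0..} s \<partial>lborel) = ennreal (1 / (D * sqrt A))"
    by (simp add: F_def)
  have "(\<integral>\<^sup>+s. ennreal ((A * (s - t0)\<^sup>2 + D) powr (-3/2)) \<partial>lborel) = (\<integral>\<^sup>+s. ennreal (h s) \<partial>lborel)"
    using nn_integral_real_affine[of "\<lambda>s. ennreal ((A * (s - t0)\<^sup>2 + D) powr (-3/2))" 1 t0]
    by (simp add: h_def)
  \<comment> \<open>Both half-lines contain 0, so the pointwise comparison is an inequality.\<close>
  also have "\<dots> \<le> (\<integral>\<^sup>+s. ennreal (h s) * indicator {0..} s + ennreal (h (- s)) * indicator {0..} (- s) \<partial>lborel)"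
    by (intro nn_integral_mono) (auto simp: h_def split: split_indicator)
  also have "\<dots> = (\<integral>\<^sup>+s. ennreal (h s) * indicator {0..} s \<partial>lborel)
      + (\<integral>\<^sup>+s. ennreal (h (- s)) * indicator {0..} (- s) \<partial>lborel)"
    by (intro nn_integral_add) auto
  also have "(\<integral>\<^sup>+s. ennreal (h (- s)) * indicator {0..} (- s) \<partial>lborel)
      = (\<integral>\<^sup>+s. ennreal (h s) * indicator {0..} s \<partial>lborel)"
    using nn_integral_real_affine[of "\<lambda>s. ennreal (h s) * indicator {0..} s" "-1" 0] by simp
  also have "(\<integral>\<^sup>+s. ennreal (h s) * indicator {0..} s \<partial>lborel)
      + (\<integral>\<^sup>+s. ennreal (h s) * indicator {0..} s \<partial>lborel) = ennreal (2 / (sqrt A * D))"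
    unfolding half using assms by (simp add: mult.commute flip: ennreal_plus)
  finally show ?thesis .
qed

text \<open>Shearing the half-plane to a horizontal one makes the inner integral one-dimensional in a
  quadratic polynomial.\<close>
lemma sphere_density_half_plane:
  fixes k c :: real
  assumes "0 < c"
  shows "(\<integral>\<^sup>+x. ennreal (sphere_density (fst x) (snd x)) * indicator {x. c \<le> k * fst x + snd x} x
      \<partial>(lborel :: (real \<times> real) measure)) \<le> ennreal (2 * sqrt (1 + k\<^sup>2) / c)"
proof -
  define A where "A = 1 + k\<^sup>2"
  have "0 < A" by (simp add: A_def add_pos_nonneg)
  \<comment> \<open>Completing the square in \<open>s\<close> brings the sheared density into the
    form of \<open>nn_integral_quadratic_powr_le\<close>.\<close>
  have square: "1 + s\<^sup>2 + (t - k * s)\<^sup>2 = A * (s - k * t / A)\<^sup>2 + (1 + t\<^sup>2 / A)" for s t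
  proof -
    have "A * (A * (s - k * t / A)\<^sup>2) = (A * s - k * t)\<^sup>2"
      using \<open>0 < A\<close> by (simp add: field_simps power2_eq_square)
    then have "A * (A * (s - k * t / A)\<^sup>2 + (1 + t\<^sup>2 / A)) = (A * s - k * t)\<^sup>2 + A + t\<^sup>2"
      using \<open>0 < A\<close> by (simp add: algebra_simps)
    also have "\<dots> = A * (1 + s\<^sup>2 + (t - k * s)\<^sup>2)"
      by (simp add: A_def power2_eq_square algebra_simps)
    finally show ?thesis using \<open>0 < A\<close> by simp
  qed
  have "(\<integral>\<^sup>+x. ennreal (sphere_density (fst x) (snd x)) * indicator {x. c \<le> k * fst x + snd x} x
      \<partial>(lborel :: (real \<times> real) measure))
    = (\<integral>\<^sup>+s. \<integral>\<^sup>+t. ennreal (sphere_density s t) * indicator {c..} (k * s + t) \<partial>lborel \<partial>lborel)"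
    unfolding lborel_prod[symmetric]
    by (subst lborel.nn_integral_fst[symmetric]) (auto intro!: nn_integral_cong split: split_indicator)
  also have "\<dots> = (\<integral>\<^sup>+s. \<integral>\<^sup>+t. ennreal (sphere_density s (t - k * s)) * indicator {c..} t \<partial>lborel \<partial>lborel)"
  proof (rule nn_integral_cong)
    fix s :: real
    show "(\<integral>\<^sup>+t. ennreal (sphere_density s t) * indicator {c..} (k * s + t) \<partial>lborel)
        = (\<integral>\<^sup>+t. ennreal (sphere_density s (t - k * s)) * indicator {c..} t \<partial>lborel)"
      using nn_integral_real_affine[of "\<lambda>t. ennreal (sphere_density s t) * indicator {c..} (k * s + t)" 1 "- (k * s)"]
      by (simp add: algebra_simps)
  qed
  also have "\<dots> = (\<integral>\<^sup>+t. \<integral>\<^sup>+s. ennreal (sphere_density s (t - k * s)) * indicator {c..} t \<partial>lborel \<partial>lborel)"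
    by (rule lborel_pair.Fubini') measurable
  also have "\<dots> \<le> (\<integral>\<^sup>+t. ennreal (2 * sqrt A / t\<^sup>2) * indicator {c..} t \<partial>lborel)"
  proof (intro nn_integral_mono)
    fix t :: real
    have "(\<integral>\<^sup>+s. ennreal (sphere_density s (t - k * s)) \<partial>lborel) \<le> ennreal (2 * sqrt A / t\<^sup>2)" if "c \<le> t"
    proof -
      have "0 < t\<^sup>2" using that \<open>0 < c\<close> by simp
      \<comment> \<open>Dropping the 1 replaces the exact lune area
        \<open>2 * arctan (sqrt A / c)\<close> by its linear bound
        \<open>2 * sqrt A / c\<close>.\<close>
      have "2 / (sqrt A * (1 + t\<^sup>2 / A)) \<le> 2 / (sqrt A * (t\<^sup>2 / A))"
        using \<open>0 < A\<close> \<open>0 < t\<^sup>2\<close> by (intro divide_left_mono mult_left_mono mult_pos_pos) (auto intro: add_pos_pos)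
      also have "2 / (sqrt A * (t\<^sup>2 / A)) = 2 * sqrt A / t\<^sup>2"
        using \<open>0 < A\<close> \<open>0 < t\<^sup>2\<close> real_sqrt_mult_self[of A] by (simp add: frac_eq_eq)
      finally have "2 / (sqrt A * (1 + t\<^sup>2 / A)) \<le> 2 * sqrt A / t\<^sup>2" .
      moreover have "(\<integral>\<^sup>+s. ennreal (sphere_density s (t - k * s)) \<partial>lborel)
          \<le> ennreal (2 / (sqrt A * (1 + t\<^sup>2 / A)))"
        unfolding sphere_density_def square using \<open>0 < A\<close>
        by (intro nn_integral_quadratic_powr_le) (auto intro: add_pos_nonneg)
      ultimately show ?thesis by (meson ennreal_leI order_trans)
    qed
    then show "(\<integral>\<^sup>+s. ennreal (sphere_density s (t - k * s)) * indicator {c..} t \<partial>lborel)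
        \<le> ennreal (2 * sqrt A / t\<^sup>2) * indicator {c..} t"
      by (auto split: split_indicator)
  qed
  also have "\<dots> = ennreal (0 - (- (2 * sqrt A / c)))"
  proof (rule nn_integral_FTC_atLeast)
    show "((\<lambda>t. - (2 * sqrt A / t)) has_real_derivative 2 * sqrt A / t\<^sup>2) (at t)" if "c \<le> t" for t
      using that \<open>0 < c\<close> by (auto intro!: derivative_eq_intros simp: power2_eq_square)
    have "((\<lambda>t. - (2 * sqrt A * inverse t)) \<longlongrightarrow> - (2 * sqrt A * 0)) at_top"
      by (intro tendsto_intros tendsto_inverse_0_at_top filterlim_ident)
    then show "((\<lambda>t. - (2 * sqrt A / t)) \<longlongrightarrow> 0) at_top" by (simp add: divide_inverse)
  qed (use \<open>0 < A\<close> in auto)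
  finally show ?thesis by (simp add: A_def)
qed

section \<open>Lebesgue measure on \<open>real ^ 2\<close> and on pairs\<close>

lemma vector_2_eq_axis: "vector [a, b] = (a *\<^sub>R axis 1 1 + b *\<^sub>R axis 2 1 :: real ^ 2)"
  by (auto simp: vec_eq_iff forall_2 axis_def)

lemma vector_pair_measurable:
  "(\<lambda>x. vector [fst x, snd x] :: real ^ 2) \<in> borel_measurable (borel :: (real \<times> real) measure)"
  unfolding vector_2_eq_axis by (auto intro!: borel_measurable_continuous_onI continuous_intros)

text \<open>The change of variables takes place on \<open>real ^ 2\<close>, the equation lives on
  pairs. The two Lebesgue measures correspond because boxes have the same volume in both.\<close>

lemma lborel_vec2: "lborel = distr (lborel :: (real \<times> real) measure) borel (\<lambda>x. vector [fst x, snd x] :: real ^ 2)"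
proof (rule lborel_eqI)
  note vector_pair_measurable [measurable]
  fix l r :: "real ^ 2"
  assume le: "\<And>b. b \<in> Basis \<Longrightarrow> l \<bullet> b \<le> r \<bullet> b"
  have le': "l $ i \<le> r $ i" for i
    using le[of "axis i 1"] by (simp add: inner_axis axis_in_Basis_iff)
  have box: "(\<lambda>x. vector [fst x, snd x]) -` box l r = box (l $ 1, l $ 2) (r $ 1, r $ 2)"
    by (auto simp: mem_box_cart forall_2 box_prod box_real)
  have "emeasure (distr (lborel :: (real \<times> real) measure) borel (\<lambda>x. vector [fst x, snd x] :: real ^ 2)) (box l r)
    = emeasure lborel (box (l $ 1, l $ 2) (r $ 1, r $ 2))"
    by (subst emeasure_distr) (auto simp: box)
  also have "\<dots> = ennreal ((r $ 1 - l $ 1) * (r $ 2 - l $ 2))"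
    using le' by (subst emeasure_lborel_box) (auto simp: Basis_prod_def prod.union_disjoint prod.reindex inj_on_def)
  also have "(r $ 1 - l $ 1) * (r $ 2 - l $ 2) = (\<Prod>b\<in>Basis. (r - l) \<bullet> b)"
    by (simp add: Basis_vec_def UNION_singleton_eq_range prod.reindex inj_on_def axis_eq_axis inner_axis UNIV_2)
  finally show "emeasure (distr (lborel :: (real \<times> real) measure) borel (\<lambda>x. vector [fst x, snd x] :: real ^ 2)) (box l r)
    = (\<Prod>b\<in>Basis. (r - l) \<bullet> b)" .
qed simp

definition pair_of_vec :: "real ^ 2 \<Rightarrow> real \<times> real" where
  "pair_of_vec v = (v $ 1, v $ 2)"

lemma bounded_linear_pair_of_vec: "bounded_linear pair_of_vec"
  unfolding pair_of_vec_def by (intro bounded_linear_Pair bounded_linear_vec_nth)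

lemma nn_integral_vec2:
  assumes [measurable]: "f \<in> borel_measurable borel"
  shows "(\<integral>\<^sup>+v. f v \<partial>(lborel :: (real ^ 2) measure)) = (\<integral>\<^sup>+x. f (vector [fst x, snd x]) \<partial>lborel)"
  using vector_pair_measurable by (subst lborel_vec2) (simp add: nn_integral_distr)

lemma nn_integral_swap_lborel:
  assumes [measurable]: "f \<in> borel_measurable borel"
  shows "(\<integral>\<^sup>+x. f x \<partial>(lborel :: (real \<times> real) measure)) = (\<integral>\<^sup>+x. f (prod.swap x) \<partial>lborel)"
proof -
  have [measurable]: "f \<in> borel_measurable (lborel \<Otimes>\<^sub>M lborel)" by (simp add: lborel_prod)
  have "(\<integral>\<^sup>+x. f x \<partial>(lborel \<Otimes>\<^sub>M lborel)) = (\<integral>\<^sup>+x. f (prod.swap x) \<partial>(lborel \<Otimes>\<^sub>M lborel))"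
    by (subst lborel_pair.distr_pair_swap) (simp add: nn_integral_distr case_prod_unfold prod.swap_def)
  then show ?thesis by (simp add: lborel_prod)
qed

section \<open>Change of variables by the gradient map\<close>

context convex_C2
begin

text \<open>By the equation the Jacobian of the gradient map times \<open>sphere_density\<close> at
  the gradient is the constant \<open>c\<close>. So the left-hand side is the mass of the gradient
  image of \<open>E\<close>, which the two half-planes in \<open>half\<close> cover.\<close>

lemma gradient_image_measure:
  fixes E :: "(real ^ 2) set"
  assumes eq: "\<And>z. z \<in> S \<Longrightarrow> hess_det u z = c * (1 + (grad_norm u z)\<^sup>2) powr (3/2)"
    and "0 < c" "E \<in> lmeasurable" and E: "pair_of_vec ` E \<subseteq> S"
    and "0 < \<tau>1" "0 < \<tau>2"
    and half: "\<And>z. z \<in> pair_of_vec ` E \<Longrightarrow> \<tau>1 \<le> px u z \<or> \<tau>2 \<le> k * px u z + py u z"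
  shows "c * measure lebesgue E \<le> 2 / \<tau>1 + 2 * sqrt (1 + k\<^sup>2) / \<tau>2"
proof -
  define g where "g = (\<lambda>v. vector [px u (pair_of_vec v), py u (pair_of_vec v)] :: real ^ 2)"
  define g' where "g' = (\<lambda>v (h :: real ^ 2). vector [h $ 1 * px (px u) (pair_of_vec v) + h $ 2 * py (px u) (pair_of_vec v),
      h $ 1 * px (py u) (pair_of_vec v) + h $ 2 * py (py u) (pair_of_vec v)] :: real ^ 2)"
  define \<rho> where "\<rho> = (\<lambda>w :: real ^ 2. sphere_density (w $ 1) (w $ 2))"
  \<comment> \<open>The density as a one-component vector, the value type in
    \<open>has_absolute_integral_change_of_variables\<close>.\<close>
  define F where "F = (\<lambda>w :: real ^ 2. vec (\<rho> w) :: real ^ 1)"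
  have inS: "pair_of_vec v \<in> S" if "v \<in> E" for v using E that by auto
  have powr_pos: "0 < (1 + (grad_norm u z)\<^sup>2) powr (3/2)" for z
    unfolding powr_gt_zero using zero_le_power2[of "grad_norm u z"] by linarith
  have pos: "0 < hess_det u z" if "z \<in> S" for z
    unfolding eq[OF that] using \<open>0 < c\<close> powr_pos by (rule mult_pos_pos)
  have partial: "((\<lambda>v. f (pair_of_vec v)) has_derivative
      (\<lambda>h. h $ 1 * px f (pair_of_vec v) + h $ 2 * py f (pair_of_vec v))) (at v within E)"
    if "f differentiable (at (pair_of_vec v))" for f v
    using has_derivative_compose[OF bounded_linear_imp_has_derivative[OF bounded_linear_pair_of_vec]
        differentiable_has_derivative_partials[OF that]]
    by (simp add: pair_of_vec_def)
  have deriv: "(g has_derivative g' v) (at v within E)" if "v \<in> E" for v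
  proof -
    show ?thesis unfolding g_def g'_def vector_2_eq_axis
      using differentiable_u[OF inS[OF that]]
      by (intro has_derivative_add has_derivative_scaleR_left partial)
  qed
  have inj: "inj_on g E"
  proof (rule inj_onI)
    fix v w assume "v \<in> E" "w \<in> E" "g v = g w"
    then have "px u (pair_of_vec v) = px u (pair_of_vec w)" "py u (pair_of_vec v) = py u (pair_of_vec w)"
      by (auto simp: g_def vec_eq_iff forall_2)
    then have "pair_of_vec v = pair_of_vec w"
      using gradient_inj[OF pos] inS \<open>v \<in> E\<close> \<open>w \<in> E\<close> by blast
    then show "v = w" by (simp add: pair_of_vec_def vec_eq_iff forall_2)
  qed
  have const: "\<bar>det (matrix (g' v))\<bar> *\<^sub>R F (g v) = vec c" if "v \<in> E" for v
  proof -
    have "det (matrix (g' v)) = hess_det u (pair_of_vec v)"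
      by (simp add: det_2 matrix_def g'_def hess_det_def axis_def)
    moreover have "\<rho> (g v) = 1 / (1 + (grad_norm u (pair_of_vec v))\<^sup>2) powr (3/2)"
      by (simp add: \<rho>_def g_def sphere_density_def grad_norm_def add.assoc powr_minus_divide)
    ultimately have "\<bar>det (matrix (g' v))\<bar> * \<rho> (g v) = c"
      using eq[OF inS[OF that]] pos[OF inS[OF that]] powr_pos[of "pair_of_vec v"] by simp
    then show ?thesis by (simp add: F_def vec_eq_iff)
  qed
  have "(\<lambda>v. \<bar>det (matrix (g' v))\<bar> *\<^sub>R F (g v)) absolutely_integrable_on E \<and>
      integral E (\<lambda>v. \<bar>det (matrix (g' v))\<bar> *\<^sub>R F (g v)) = measure lebesgue E *\<^sub>R vec c"
  proof -
    have "(\<lambda>v. vec c :: real ^ 1) absolutely_integrable_on E"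
      using \<open>E \<in> lmeasurable\<close> absolutely_integrable_on_const by blast
    moreover have "integral E (\<lambda>v. vec c :: real ^ 1) = measure lebesgue E *\<^sub>R vec c"
      using lmeasure_integral[OF \<open>E \<in> lmeasurable\<close>] integrable_on_const[OF \<open>E \<in> lmeasurable\<close>, of "1 :: real"]
        integral_linear[of "\<lambda>v. 1 :: real" E "\<lambda>r. r *\<^sub>R (vec c :: real ^ 1)"]
      by (simp add: o_def bounded_linear_scaleR_left)
    ultimately show ?thesis
      using const by (simp cong: set_integrable_cong Henstock_Kurzweil_Integration.integral_cong)
  qed
  then have F_int: "F absolutely_integrable_on g ` E"
    and F_val: "integral (g ` E) F = measure lebesgue E *\<^sub>R vec c"
    using has_absolute_integral_change_of_variables[OF fmeasurableD[OF \<open>E \<in> lmeasurable\<close>] deriv inj] by blast+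
  have \<rho>_eq: "\<rho> = (\<lambda>w. F w $ 1)" by (simp add: F_def)
  have \<rho>_int: "\<rho> absolutely_integrable_on g ` E"
    unfolding \<rho>_eq using absolutely_integrable_linear[OF F_int bounded_linear_vec_nth[of 1]]
    by (simp add: o_def)
  have \<rho>_val: "integral (g ` E) \<rho> = c * measure lebesgue E"
    unfolding \<rho>_eq using F_int F_val
    by (simp add: integral_component_eq_cart absolutely_integrable_on_def mult.commute)
  have \<rho>_nonneg: "0 \<le> \<rho> w" for w by (simp add: \<rho>_def sphere_density_def)
  have \<rho>_meas [measurable]: "\<rho> \<in> borel_measurable borel"
    unfolding \<rho>_def by measurable
  define H1 where "H1 = {w :: real ^ 2. \<tau>1 \<le> w $ 1}"
  define H2 where "H2 = {w :: real ^ 2. \<tau>2 \<le> k * w $ 1 + w $ 2}"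
  have [measurable]: "H1 \<in> sets borel" "H2 \<in> sets borel"
    unfolding H1_def H2_def by measurable
  have "ennreal (c * measure lebesgue E) = (\<integral>\<^sup>+w. ennreal (indicator (g ` E) w *\<^sub>R \<rho> w) \<partial>lebesgue)"
    using \<rho>_int \<rho>_val set_lebesgue_integral_eq_integral(2)[OF \<rho>_int]
      nn_integral_eq_integral[of lebesgue "\<lambda>w. indicator (g ` E) w *\<^sub>R \<rho> w"] \<rho>_nonneg
    by (simp add: set_integrable_def set_lebesgue_integral_def)
  also have "\<dots> \<le> (\<integral>\<^sup>+w. ennreal (\<rho> w) * indicator H1 w + ennreal (\<rho> w) * indicator H2 w \<partial>lebesgue)"
  proof (intro nn_integral_mono)
    fix w
    have "g v \<in> H1 \<or> g v \<in> H2" if "v \<in> E" for v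
      using half[OF imageI[OF that]] by (simp add: H1_def H2_def g_def)
    then have "w \<in> H1 \<or> w \<in> H2" if "w \<in> g ` E" using that by blast
    then show "ennreal (indicator (g ` E) w *\<^sub>R \<rho> w) \<le> ennreal (\<rho> w) * indicator H1 w + ennreal (\<rho> w) * indicator H2 w"
      by (auto split: split_indicator)
  qed
  also have "\<dots> = (\<integral>\<^sup>+w. ennreal (\<rho> w) * indicator H1 w \<partial>lborel) + (\<integral>\<^sup>+w. ennreal (\<rho> w) * indicator H2 w \<partial>lborel)"
    unfolding nn_integral_completion by (intro nn_integral_add) auto
  also have "(\<integral>\<^sup>+w. ennreal (\<rho> w) * indicator H2 w \<partial>lborel) \<le> ennreal (2 * sqrt (1 + k\<^sup>2) / \<tau>2)"
    using sphere_density_half_plane[OF \<open>0 < \<tau>2\<close>, of k]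
    by (subst nn_integral_vec2) (auto simp: \<rho>_def H2_def indicator_def)
  also have "(\<integral>\<^sup>+w. ennreal (\<rho> w) * indicator H1 w \<partial>lborel) \<le> ennreal (2 / \<tau>1)"
  proof -
    have "(\<integral>\<^sup>+w. ennreal (\<rho> w) * indicator H1 w \<partial>lborel)
        = (\<integral>\<^sup>+x. ennreal (sphere_density (fst x) (snd x)) * indicator {x. \<tau>1 \<le> fst x} x \<partial>(lborel :: (real \<times> real) measure))"
      by (subst nn_integral_vec2) (auto simp: \<rho>_def H1_def indicator_def)
    \<comment> \<open>A vertical half-plane becomes the case \<open>k = 0\<close> of
      \<open>sphere_density_half_plane\<close> after swapping coordinates.\<close>
    also have "\<dots> = (\<integral>\<^sup>+x. ennreal (sphere_density (fst x) (snd x)) * indicator {x. \<tau>1 \<le> 0 * fst x + snd x} x \<partial>(lborel :: (real \<times> real) measure))"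
    proof -
      have "(\<lambda>x. ennreal (sphere_density (fst x) (snd x)) * indicator {x. \<tau>1 \<le> fst x} x)
          \<in> borel_measurable (borel \<Otimes>\<^sub>M borel)"
        by measurable
      from nn_integral_swap_lborel[OF this[unfolded borel_prod]] show ?thesis
        by (simp add: indicator_def sphere_density_commute)
    qed
    also have "\<dots> \<le> ennreal (2 / \<tau>1)"
      using sphere_density_half_plane[OF \<open>0 < \<tau>1\<close>, of 0] by simp
    finally show ?thesis .
  qed
  finally show ?thesis
    using assms(5,6) by (simp flip: ennreal_plus)
qed

end

section \<open>The gradient estimate\<close>

text \<open>Follows from \<open>sin x \<le> x\<close> and
  \<open>1 - x\<^sup>2 / 2 \<le> cos x\<close>. The constant is 2/3 so that three times the bound,
  plus 2, is exactly \<open>3 / x\<close>.\<close>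

lemma cot_ge_inverse_minus:
  fixes x :: real
  assumes "0 < x" "x \<le> 1"
  shows "1 / x - 2 / 3 \<le> cot x"
proof -
  have "0 < sin x" using assms pi_gt3 by (intro sin_gt_zero) auto
  have "(sin (x / 2))\<^sup>2 \<le> (x / 2)\<^sup>2"
    using abs_sin_x_le_abs_x[of "x / 2"] by (simp only: abs_le_square_iff)
  then have "1 - x\<^sup>2 / 2 \<le> cos x"
    using cos_double_sin[of "x / 2"] by (simp add: power2_eq_square)
  moreover have "x\<^sup>2 / 2 \<le> 2 * x / 3"
    using assms mult_left_mono[of x 1 x] by (simp add: power2_eq_square)
  moreover have "sin x * (1 / x - 2 / 3) \<le> x * (1 / x - 2 / 3)"
    using assms sin_x_le_x[of x] by (intro mult_right_mono) (auto simp: field_simps)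
  then have "sin x * (1 / x - 2 / 3) \<le> 1 - 2 * x / 3"
    using assms by (simp add: algebra_simps)
  ultimately have "sin x * (1 / x - 2 / 3) \<le> cos x" by linarith
  then show ?thesis
    using \<open>0 < sin x\<close> by (simp add: cot_def pos_le_divide_eq mult.commute)
qed

theorem theorem4p4:
  fixes \<Omega> :: "(real \<times> real) set" and u :: "real \<times> real \<Rightarrow> real"
    and \<epsilon> \<alpha> :: real
  assumes "open \<Omega>" and "strictly_convex \<Omega>" and "smooth_boundary \<Omega>"
    and "axially_symmetric \<Omega>"
    and "{-1..1} \<times> {-1..1} \<subseteq> \<Omega>"
    and "\<Omega> \<subseteq> {-4/3..4/3} \<times> {-4/3..4/3}"
    and "convex_on \<Omega> u" and "C2_on \<Omega> u"
    and "\<forall>p\<in>\<Omega>. hess_det u p / (1 + (grad_norm u p)\<^sup>2) powr (3/2)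
                 = 2 * pi / measure lebesgue \<Omega>"
    and "\<forall>z\<in>frontier \<Omega>. filterlim (grad_norm u) at_top (at z within \<Omega>)"
    and "0 < \<epsilon>" and "\<epsilon> < 1/2" and "0 < \<alpha>" and "\<alpha> < 1/6"
  shows "px u (1 - 5 * \<alpha>, -1 + \<epsilon>) \<le> 2 + 3 * cot (pi * \<alpha>\<^sup>2 / 2)"
proof (rule ccontr)
  note square = assms(5) and bounds = assms(11-14)
  interpret convex_C2 \<Omega> u by unfold_locales fact+
  define c where "c = 2 * pi / measure lebesgue \<Omega>"
  \<comment> \<open>The outer square has area 64/9. The inner square makes the area positive, as the
    division requires.\<close>
  have c_ge: "9 * pi / 32 \<le> c"
  proof -
    have rect: "measure lebesgue ({-r..r} \<times> {-r..r}) = 4 * r\<^sup>2" "{-r..r} \<times> {-r..r} \<in> lmeasurable"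
      if "0 \<le> r" for r :: real
    proof -
      have eq: "{-r..r} \<times> {-r..r} = cbox (-r, -r) (r, r)" by (simp add: cbox_Pair_eq)
      show "measure lebesgue ({-r..r} \<times> {-r..r}) = 4 * r\<^sup>2"
        unfolding eq using that by (simp add: content_Pair power2_eq_square)
      show "{-r..r} \<times> {-r..r} \<in> lmeasurable" unfolding eq by simp
    qed
    have "bounded \<Omega>"
      using assms(6) by (rule bounded_subset[rotated]) (simp add: bounded_Times)
    then have "\<Omega> \<in> lmeasurable" using \<open>open \<Omega>\<close> by (rule lmeasurable_open)
    then have "measure lebesgue ({-1..1} \<times> {-1..1} :: (real \<times> real) set) \<le> measure lebesgue \<Omega>"
      by (rule measure_mono_fmeasurable[OF square fmeasurableD[OF rect(2)[OF zero_le_one]]])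
    then have "4 \<le> measure lebesgue \<Omega>" by (simp only: rect(1)[OF zero_le_one] power_one mult_1_right)
    have "\<Omega> \<subseteq> {-(4/3)..4/3} \<times> {-(4/3)..4/3}" using assms(6) by simp
    from measure_mono_fmeasurable[OF this fmeasurableD[OF \<open>\<Omega> \<in> lmeasurable\<close>] rect(2)]
    have "measure lebesgue \<Omega> \<le> 4 * (4/3)\<^sup>2" by (simp only: rect(1))
    then have "measure lebesgue \<Omega> \<le> 64 / 9" by (simp add: power2_eq_square)
    have "9 * pi / 32 * measure lebesgue \<Omega> \<le> 9 * pi / 32 * (64 / 9)"
      using \<open>measure lebesgue \<Omega> \<le> 64 / 9\<close> by (intro mult_left_mono) auto
    with \<open>4 \<le> measure lebesgue \<Omega>\<close> show ?thesis
      unfolding c_def by (simp add: pos_le_divide_eq)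
  qed
  have "0 < c" using c_ge pi_gt_zero by linarith
  have hess: "hess_det u z = c * (1 + (grad_norm u z)\<^sup>2) powr (3/2)" if "z \<in> \<Omega>" for z
  proof -
    have "(1 + (grad_norm u z)\<^sup>2) powr (3/2) > 0"
      unfolding powr_gt_zero using zero_le_power2[of "grad_norm u z"] by linarith
    moreover have "hess_det u z / (1 + (grad_norm u z)\<^sup>2) powr (3/2) = c"
      using assms(9) that unfolding c_def by blast
    ultimately show ?thesis by (metis nonzero_divide_eq_eq less_irrefl)
  qed
  \<comment> \<open>Chosen so that \<open>2 / K\<close> is the lower bound
    \<open>9 * pi / 32\<close> for \<open>c\<close>.\<close>
  define K where "K = 64 / (9 * pi)"
  have "0 < K" by (simp add: K_def)
  have det: "2 / K * (1 + (grad_norm u z)\<^sup>2) powr (3/2) \<le> hess_det u z" if "z \<in> \<Omega>" for z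
    unfolding hess[OF that] using c_ge by (intro mult_right_mono) (auto simp: K_def)

  define N where "N = 6 / (pi * \<alpha>\<^sup>2)"
  define x1 where "x1 = 1 - 5 * \<alpha>"
  define y1 where "y1 = -1 + \<epsilon>"
  assume "\<not> ?thesis"
  moreover have "N \<le> 2 + 3 * cot (pi * \<alpha>\<^sup>2 / 2)"
  proof -
    have "pi * \<alpha>\<^sup>2 \<le> 4 * (1/6)\<^sup>2"
      using bounds pi_less_4 by (intro mult_mono power_mono) auto
    then have "1 / (pi * \<alpha>\<^sup>2 / 2) - 2 / 3 \<le> cot (pi * \<alpha>\<^sup>2 / 2)"
      using bounds by (intro cot_ge_inverse_minus) (auto simp: power2_eq_square)
    then show ?thesis by (simp add: N_def)
  qed
  ultimately have N: "N \<le> px u (x1, y1)" by (simp add: x1_def y1_def)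

  \<comment> \<open>The minimum \<open>2 * sqrt (K * N)\<close> of \<open>N * d + K / d\<close> is
    about \<open>13.064 / (pi * \<alpha>)\<close>, here rounded up.\<close>
  define B where "B = 13.08 / (pi * \<alpha>)"
  \<comment> \<open>close to the minimiser \<^term>\<open>sqrt (K / N)\<close> of \<^term>\<open>N * d + K / d\<close>\<close>
  define d where "d = 1.09 * \<alpha>"
  have "0 < d" using bounds by (simp add: d_def)
  have K_d: "K / d = (64 / 9.81) / (pi * \<alpha>)" using bounds by (simp add: K_def d_def)
  have N_d: "N * (r * \<alpha>) = 6 * r / (pi * \<alpha>)" for r
    using bounds by (simp add: N_def power2_eq_square)
  have B: "N * d + K / d \<le> B"
    unfolding K_d unfolding d_def N_d B_def add_divide_distrib[symmetric]
    using bounds by (intro divide_right_mono) auto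
  \<comment> \<open>The tangent at \<open>q\<close>, evaluated at the base point
    \<open>(x1, y1)\<close>, turns the lower bound for \<open>u q\<close> from
    \<open>value_lower_bound\<close> into one for the gradient at \<open>q\<close>. The factor 1.91
    below is 3 - 1.09.\<close>
  have slope: "N * (fst q - x1) - B \<le> (fst q - x1) * px u q + (snd q - y1) * py u q"
    if "x1 + 3 * \<alpha> \<le> fst q" "fst q \<le> 1" "y1 \<le> snd q" "snd q \<le> 1" for q
  proof -
    have "{x1..fst q} \<times> {y1..snd q} \<subseteq> {-1..1} \<times> {-1..1}"
      using that bounds by (intro Sigma_mono) (auto simp: x1_def y1_def)
    then have box: "{x1..fst q} \<times> {y1..snd q} \<subseteq> \<Omega>" using square by blast
    have "(64 / 9.81) / (pi * \<alpha>) < 6 * 1.91 / (pi * \<alpha>)"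
      using bounds by (intro divide_strict_right_mono) auto
    also have "\<dots> = N * (1.91 * \<alpha>)" by (simp only: N_d)
    also have "\<dots> \<le> N * (fst q - x1 - d)"
      using that bounds by (intro mult_left_mono) (auto simp: d_def N_def)
    finally have "u (x1, y1) + N * (fst q - x1) - (N * d + K / d) \<le> u (fst q, snd q)"
      using that bounds \<open>0 < d\<close> unfolding K_d[symmetric]
      by (intro value_lower_bound[OF \<open>0 < K\<close> _ box det N]) (auto simp: d_def)
    moreover have "q \<in> \<Omega>" "(x1, y1) \<in> \<Omega>"
      using that bounds by (auto intro!: subsetD[OF box] simp: mem_Times_iff)
    then have "u q + (fst ((x1, y1) - q) * px u q + snd ((x1, y1) - q) * py u q) \<le> u (x1, y1)"
      by (rule above_tangent)
    ultimately show ?thesis using B by (simp add: algebra_simps)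
  qed

  \<comment> \<open>All of this triangle lies in the range of \<open>slope\<close>:
    \<open>1 - 2 * \<alpha> = x1 + 3 * \<alpha>\<close>, and
    \<open>y1 + 3/2 = 1/2 + \<epsilon> < 1\<close>.\<close>
  define E :: "(real ^ 2) set" where
    "E = convex hull {vector [1 - 2 * \<alpha>, y1], vector [1, y1], vector [1, y1 + 3/2]}"
  have "compact E" unfolding E_def by (intro finite_imp_compact_convex_hull) auto
  then have "E \<in> lmeasurable" by (rule lmeasurable_compact)
  have E_area: "measure lebesgue E = 3 / 2 * \<alpha>"
  proof -
    have "measure lebesgue E = measure lborel E"
      using \<open>compact E\<close> by (intro measure_completion) (simp add: borel_compact)
    also have "\<dots> = 3 / 2 * \<alpha>"
      unfolding E_def content_triangle using bounds by simp
    finally show ?thesis .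
  qed
  \<comment> \<open>With the gradient at \<open>q\<close> frozen, \<open>slope\<close> is an affine
    inequality in the point, true at \<open>q\<close> and hence at a vertex of \<open>E\<close>. The
    vertices have offsets \<open>(3 * \<alpha>, 0)\<close>, \<open>(5 * \<alpha>, 0)\<close> and
    \<open>(5 * \<alpha>, 3/2)\<close> from \<open>(x1, y1)\<close>.\<close>
  have E_slopes: "pair_of_vec v \<in> \<Omega>
      \<and> (1.64 / (pi * \<alpha>\<^sup>2) \<le> px u (pair_of_vec v)
        \<or> 11.28 / (pi * \<alpha>) \<le> 10 / 3 * \<alpha> * px u (pair_of_vec v) + py u (pair_of_vec v))" if vE: "v \<in> E" for v
  proof -
    obtain a b e where w: "0 \<le> a" "0 \<le> b" "0 \<le> e" "a + b + e = 1" and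
      v: "v = a *\<^sub>R vector [1 - 2 * \<alpha>, y1] + b *\<^sub>R vector [1, y1] + e *\<^sub>R vector [1, y1 + 3/2]"
      using vE unfolding E_def convex_hull_3 by auto
    define q where "q = pair_of_vec v"
    have q: "fst q = a * (1 - 2 * \<alpha>) + b + e" "snd q = a * y1 + b * y1 + e * (y1 + 3/2)"
      by (simp_all add: q_def pair_of_vec_def v)
    have "fst q = (a + b + e) - 2 * \<alpha> * a" "snd q = (a + b + e) * y1 + 3/2 * e"
      unfolding q by (simp_all add: algebra_simps)
    then have q': "fst q = 1 - 2 * \<alpha> * a" "snd q = y1 + 3/2 * e" unfolding w(4) by simp_all
    have "\<alpha> * a \<le> \<alpha> * 1" "0 \<le> \<alpha> * a" "e \<le> 1" using w bounds by (auto intro: mult_left_mono)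
    then have range: "x1 + 3 * \<alpha> \<le> fst q" "fst q \<le> 1" "y1 \<le> snd q" "snd q \<le> 1"
      using w bounds by (auto simp: q' x1_def y1_def)
    then have "q \<in> {-1..1} \<times> {-1..1}"
      using bounds by (auto simp: mem_Times_iff x1_def y1_def)
    then have "q \<in> \<Omega>" using square by blast
    have dq: "fst q - x1 = (a + b + e) * (5 * \<alpha>) - 2 * \<alpha> * a" "snd q - y1 = 3/2 * e"
      by (simp_all add: q' x1_def w(4))
    have "a * (3 * \<alpha> * (px u q - N) + B) + b * (5 * \<alpha> * (px u q - N) + B)
        + e * (5 * \<alpha> * (px u q - N) + 3/2 * py u q + B)
      = (fst q - x1) * (px u q - N) + (snd q - y1) * py u q + (a + b + e) * B"
      unfolding dq by (simp add: algebra_simps)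
    also have "\<dots> \<ge> 0" using slope[OF range] unfolding w(4) by (simp add: algebra_simps)
    finally have nonneg: "0 \<le> a * (3 * \<alpha> * (px u q - N) + B) + b * (5 * \<alpha> * (px u q - N) + B)
        + e * (5 * \<alpha> * (px u q - N) + 3/2 * py u q + B)" .
    have "0 \<le> 3 * \<alpha> * (px u q - N) + B \<or> 0 \<le> 5 * \<alpha> * (px u q - N) + B
        \<or> 0 \<le> 5 * \<alpha> * (px u q - N) + 3/2 * py u q + B"
    proof (rule ccontr)
      assume neg: "\<not> ?thesis"
      define m where "m = max (3 * \<alpha> * (px u q - N) + B)
        (max (5 * \<alpha> * (px u q - N) + B) (5 * \<alpha> * (px u q - N) + 3/2 * py u q + B))"
      have "0 \<le> a * m + b * m + e * m"
        by (rule order_trans[OF nonneg]) (intro add_mono mult_left_mono w, auto simp: m_def)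
      then have "0 \<le> m" using w(4) by (simp flip: distrib_right)
      then show False using neg by (auto simp: m_def)
    qed
    moreover have N\<alpha>: "\<alpha> * N = 6 / (pi * \<alpha>)" using N_d[of 1] by (simp add: mult.commute)
    have low: "1.64 / (pi * \<alpha>\<^sup>2) = (1.64 / (pi * \<alpha>)) / \<alpha>" by (simp add: power2_eq_square)
    \<comment> \<open>In units of \<open>t\<close> the vertices give 6 - 13.08/3 = 1.64, the
      stronger 6 - 13.08/5, and (2/3)(30 - 13.08) = 11.28, so two half-planes remain.\<close>
    define t where "t = 1 / (pi * \<alpha>)"
    have t: "\<alpha> * N = 6 * t" "B = 13.08 * t" "1.64 / (pi * \<alpha>) = 1.64 * t" "11.28 / (pi * \<alpha>) = 11.28 * t" "0 < t"
      using N\<alpha> bounds by (simp_all add: t_def B_def)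
    ultimately have "1.64 * t \<le> px u q * \<alpha> \<or> 11.28 * t \<le> 10 / 3 * \<alpha> * px u q + py u q"
      unfolding right_diff_distrib by (auto simp: algebra_simps)
    then show ?thesis
      using \<open>q \<in> \<Omega>\<close> bounds unfolding q_def[symmetric] low t by (auto simp: pos_divide_le_eq)
  qed
  have "c * measure lebesgue E \<le> 2 / (1.64 / (pi * \<alpha>\<^sup>2)) + 2 * sqrt (1 + (10 / 3 * \<alpha>)\<^sup>2) / (11.28 / (pi * \<alpha>))"
  proof (rule gradient_image_measure[OF hess \<open>0 < c\<close> \<open>E \<in> lmeasurable\<close>])
    show "pair_of_vec ` E \<subseteq> \<Omega>" using E_slopes by blast
    show "1.64 / (pi * \<alpha>\<^sup>2) \<le> px u z \<or> 11.28 / (pi * \<alpha>) \<le> 10 / 3 * \<alpha> * px u z + py u z"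
      if "z \<in> pair_of_vec ` E" for z
      using E_slopes that by blast
  qed (use bounds in simp_all)
  also have "\<dots> = (2 / 1.64 * \<alpha> + 2 / 11.28 * sqrt (1 + (10 / 3 * \<alpha>)\<^sup>2)) * (pi * \<alpha>)"
    by (simp add: power2_eq_square algebra_simps)
  \<comment> \<open>The fraction is 9/32 times 3/2, from \<open>c_ge\<close> and the area of
    \<open>E\<close>; for \<alpha> below 1/6 the left factor stays under 0.408.\<close>
  also have "\<dots> < 27 / 64 * (pi * \<alpha>)"
  proof (rule mult_strict_right_mono)
    have "(10 / 3 * \<alpha>)\<^sup>2 \<le> (10 / 3 * (1 / 6))\<^sup>2" using bounds by (intro power_mono) auto
    then have "sqrt (1 + (10 / 3 * \<alpha>)\<^sup>2) \<le> 1.15"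
      by (intro real_le_lsqrt) (auto simp: power2_eq_square)
    then show "2 / 1.64 * \<alpha> + 2 / 11.28 * sqrt (1 + (10 / 3 * \<alpha>)\<^sup>2) < 27 / 64"
      using bounds by simp
  qed (use bounds in simp)
  also have "\<dots> = 9 * pi / 32 * (3 / 2 * \<alpha>)" by simp
  also have "\<dots> \<le> c * (3 / 2 * \<alpha>)" using c_ge bounds by (intro mult_right_mono) auto
  finally show False unfolding E_area by simp
qed

end
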